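(* Let $\mathbb G$ be a Carnot group, let $0<s<1$ and let $u\in\mathscr D(\mathbb G)$. Then the two definitions of the fractional sub-Laplacean $(-\mathscr L)^su$, namely $$-\frac{s}{\Gamma(1-s)}\int_0^\infty t^{-s-1}\left[P_tu(x)-u(x)\right]dt$$ and $$(-\mathscr Lu)\star R_{2-2s}(x)=-\int_{\mathbb G}\mathscr Lu(y)\,R_{2-2s}(y^{-1}\circ x)\,dy,$$ coincide.
   Context: $\mathbb G$ is a Carnot group, identified with $\mathbb R^n$ ($n\ge3$) via exponential coordinates, with group law $\circ$ and homogeneous dimension $Q$ with respect to its anisotropic dilations; $dy$ is Haar (Lebesgue) measure. $\mathscr X=\{X_1,\dots,X_m\}$ is a left-invariant basis of the horizontal (first) layer and $\mathscr L=-\sum_{i=1}^mX_i^\star X_i=\sum_{i=1}^m X_i^2$ is the sub-Laplacean. $\mathscr D(\mathbb G)=C_0^\infty(\mathbb G)$. $p(x,t)$ is the heat kernel in $\mathbb G$ (of $\partial_t-\mathscr L$), and $P_tu(x)=\int_{\mathbb G}p(y^{-1}\circ x,t)\,u(y)\,dy$ is the heat semigroup $e^{t\mathscr L}$. The group convolution is $f\star g(x)=\int_{\mathbb G}f(y)\,g(y^{-1}\circ x)\,dy$. For $0<\beta<Q$, Folland's Riesz kernel is $$R_\beta(x)=\frac1{\Gamma(\beta/2)}\int_0^\infty t^{\frac\beta2}p(x,t)\,\frac{dt}{t}.$$ Here $\Gamma(\cdot)$ is Euler's gamma function. *)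

theory Defs
  imports "HOL-Analysis.Analysis"
begin

section \<open>Smooth functions and test functions\<close>

text \<open>Meant for open \<open>S\<close>: all iterated directional derivatives up to order \<open>k\<close> exist and are
  continuous.\<close>

primrec Ck_on :: "nat \<Rightarrow> 'a::real_normed_vector set \<Rightarrow> ('a \<Rightarrow> 'b::real_normed_vector) \<Rightarrow> bool" where
  "Ck_on 0 S f \<longleftrightarrow> continuous_on S f"
| "Ck_on (Suc k) S f \<longleftrightarrow> (\<forall>x\<in>S. f differentiable (at x)) \<and>
     (\<forall>v. Ck_on k S (\<lambda>x. frechet_derivative f (at x) v))"

definition smooth_on :: "'a::real_normed_vector set \<Rightarrow> ('a \<Rightarrow> 'b::real_normed_vector) \<Rightarrow> bool" where
  "smooth_on S f \<longleftrightarrow> (\<forall>k. Ck_on k S f)"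

definition test_fun :: "('a::real_normed_vector \<Rightarrow> real) \<Rightarrow> bool" where
  "test_fun u \<longleftrightarrow> smooth_on UNIV u \<and> compact (closure {x. u x \<noteq> 0})"

section \<open>Carnot groups in exponential coordinates\<close>

text \<open>The left-invariant vector field with value \<open>v\<close> at the identity \<open>0\<close>, acting as a derivation. In
  exponential coordinates the one-parameter subgroup generated by \<open>v\<close> is \<open>t \<mapsto> t v\<close>.\<close>

definition linv_field ::
  "('a::real_normed_vector \<Rightarrow> 'a \<Rightarrow> 'a) \<Rightarrow> 'a \<Rightarrow> ('a \<Rightarrow> real) \<Rightarrow> 'a \<Rightarrow> real" where
  "linv_field gm v f x = deriv (\<lambda>t. f (gm x (t *\<^sub>R v))) 0"

text \<open>The bracket of the Lie algebra, identified with the tangent space at \<open>0\<close>: the value at \<open>0\<close> of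
  the commutator of the two left-invariant fields, read off on the coordinate functions.\<close>

definition lie_bracket ::
  "(real^'n \<Rightarrow> real^'n \<Rightarrow> real^'n) \<Rightarrow> real^'n \<Rightarrow> real^'n \<Rightarrow> real^'n" where
  "lie_bracket gm v w = (\<chi> i.
     linv_field gm v (linv_field gm w (\<lambda>x. x $ i)) 0 - linv_field gm w (linv_field gm v (\<lambda>x. x $ i)) 0)"

text \<open>The coordinates are adapted to the stratification: the \<open>i\<close>-th coordinate belongs to the layer of
  degree \<open>\<sigma> i\<close>. Degrees \<open>j\<close> that do not occur give the zero space.\<close>

definition layer :: "('n \<Rightarrow> nat) \<Rightarrow> nat \<Rightarrow> (real^'n) set" where
  "layer \<sigma> j = {v. \<forall>i. v $ i \<noteq> 0 \<longrightarrow> \<sigma> i = j}"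

definition dil :: "('n \<Rightarrow> nat) \<Rightarrow> real \<Rightarrow> real^'n \<Rightarrow> real^'n" where
  "dil \<sigma> r x = (\<chi> i. r ^ \<sigma> i * x $ i)"

text \<open>A Lie group structure on \<open>\<real>\<^sup>n\<close> whose exponential map is the identity (\<open>one_parameter\<close>), whose Lie
  algebra is stratified, and for which the anisotropic dilations are automorphisms. Since there are
  only finitely many degrees, \<open>stratified\<close> includes \<open>[V\<^sub>1, V\<^sub>r] = 0\<close> for the last layer \<open>V\<^sub>r\<close>, hence
  nilpotency. Lebesgue measure \<open>lborel\<close> is then the (bi-invariant) Haar measure.\<close>

locale carnot_group = Groups.group gm 0 ginv
  for gm :: "real^'n \<Rightarrow> real^'n \<Rightarrow> real^'n" and ginv :: "real^'n \<Rightarrow> real^'n" +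
  fixes \<sigma> :: "'n \<Rightarrow> nat"
  assumes smooth_mult: "smooth_on UNIV (\<lambda>(x, y). gm x y)"
    and smooth_inv: "smooth_on UNIV ginv"
    and one_parameter: "gm (a *\<^sub>R x) (b *\<^sub>R x) = (a + b) *\<^sub>R x"
    and degree_pos: "\<sigma> i \<ge> 1"
    and stratified: "j \<ge> 1 \<Longrightarrow>
      span {lie_bracket gm v w | v w. v \<in> layer \<sigma> 1 \<and> w \<in> layer \<sigma> j} = layer \<sigma> (j + 1)"
    and dil_mult: "r > 0 \<Longrightarrow> dil \<sigma> r (gm x y) = gm (dil \<sigma> r x) (dil \<sigma> r y)"

definition horizontal_basis :: "('n \<Rightarrow> nat) \<Rightarrow> (real^'n) set \<Rightarrow> bool" where
  "horizontal_basis \<sigma> B \<longleftrightarrow> independent B \<and> span B = layer \<sigma> 1"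

definition sublap ::
  "('a::real_normed_vector \<Rightarrow> 'a \<Rightarrow> 'a) \<Rightarrow> 'a set \<Rightarrow> ('a \<Rightarrow> real) \<Rightarrow> 'a \<Rightarrow> real" where
  "sublap gm B u x = (\<Sum>v\<in>B. linv_field gm v (linv_field gm v u) x)"

definition gconv ::
  "('a::euclidean_space \<Rightarrow> 'a \<Rightarrow> 'a) \<Rightarrow> ('a \<Rightarrow> 'a) \<Rightarrow> ('a \<Rightarrow> real) \<Rightarrow> ('a \<Rightarrow> real) \<Rightarrow> 'a \<Rightarrow> real" where
  "gconv gm ginv f g x = (LINT y|lborel. f y * g (gm (ginv y) x))"

section \<open>Heat kernel, heat semigroup and Riesz kernels\<close>

text \<open>The heat kernel is the fundamental solution of \<open>\<partial>\<^sub>t - \<L>\<close> with pole at the origin, in the sense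
  of Bonfiglioli, Lanconelli and Uguzzoni: extended by \<open>0\<close> to \<open>t \<le> 0\<close>, it is nonnegative, smooth off
  the pole and vanishes at infinity in space-time, and it is the solution for \<open>t > 0\<close> of the heat
  equation with initial datum the Dirac mass at \<open>0\<close>. These properties determine it uniquely. The value
  \<open>p 0 0 = 0\<close> is a convention.\<close>

definition heat_kernel ::
  "('a::euclidean_space \<Rightarrow> 'a \<Rightarrow> 'a) \<Rightarrow> 'a set \<Rightarrow> ('a \<Rightarrow> real \<Rightarrow> real) \<Rightarrow> bool" where
  "heat_kernel gm B p \<longleftrightarrow>
     (\<forall>x t. 0 \<le> p x t) \<and>
     (\<forall>x t. t \<le> 0 \<longrightarrow> p x t = 0) \<and>
     smooth_on (- {(0, 0)}) (\<lambda>(x, t). p x t) \<and>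
     ((\<lambda>(x, t). p x t) \<longlongrightarrow> 0) at_infinity \<and>
     (\<forall>x. \<forall>t>0. ((\<lambda>t. p x t) has_real_derivative sublap gm B (\<lambda>x. p x t) x) (at t)) \<and>
     (\<forall>\<phi>. test_fun \<phi> \<longrightarrow> ((\<lambda>t. LINT x|lborel. p x t * \<phi> x) \<longlongrightarrow> \<phi> 0) (at_right 0))"

definition heat_semigroup ::
  "('a::euclidean_space \<Rightarrow> 'a \<Rightarrow> 'a) \<Rightarrow> ('a \<Rightarrow> 'a) \<Rightarrow> ('a \<Rightarrow> real \<Rightarrow> real) \<Rightarrow> real \<Rightarrow> ('a \<Rightarrow> real) \<Rightarrow> 'a \<Rightarrow> real" where
  "heat_semigroup gm ginv p t u x = (LINT y|lborel. p (gm (ginv y) x) t * u y)"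

text \<open>For \<open>0 < \<beta> < Q\<close>, with \<open>Q = (\<Sum>i\<in>UNIV. \<sigma> i)\<close> the homogeneous dimension. The integral diverges at
  \<open>x = 0\<close>, where this real-valued version takes an irrelevant value on a null set.\<close>

definition riesz_kernel :: "('a \<Rightarrow> real \<Rightarrow> real) \<Rightarrow> real \<Rightarrow> 'a \<Rightarrow> real" where
  "riesz_kernel p \<beta> x = 1 / Gamma (\<beta> / 2) * (LINT t:{0<..}|lborel. t powr (\<beta> / 2) * p x t / t)"

end

theory Submission
  imports Defs
begin

text \<open>Write \<open>P\<^sub>t u - u = \<integral>\<^sub>0\<^sup>t P\<^sub>\<tau> \<L>u d\<tau>\<close>. Multiplying by \<open>t\<close> to the power \<open>-s-1\<close> and integrating over
  \<open>t > 0\<close> (by parts) turns the first definition into the integral of \<open>P\<^sub>\<tau> \<L>u(x)\<close> against \<open>\<tau>\<close> to the power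
  \<open>-s\<close>, which by Fubini is the convolution of \<open>\<L>u\<close> with the Riesz kernel. Absolute convergence at infinity
  needs the decay of order \<open>t\<close> to the power \<open>-Q/2\<close> of \<open>P\<^sub>t f\<close>, at zero only its boundedness.

  Neither the symmetry \<open>p(x, t) = p(x\<^sup>-\<^sup>1, t)\<close> nor the homogeneity of the heat kernel is used: the formula for
  \<open>P\<^sub>t u - u\<close> and the scaling law behind the decay both say that a certain solution of the heat
  equation vanishes, and this follows from the weak maximum principle, since the solution is
  continuous up to \<open>t = 0\<close>, has zero initial datum and tends to zero at infinity.\<close>

section \<open>Calculus of smooth functions\<close>

text \<open>The semigroup convolves \<open>u\<close> with \<open>p\<close>, so left-invariant fields
  fall on \<open>p\<close>, where the heat equation holds. Moving them onto \<open>u\<close> would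
  turn them into right-invariant fields acting on \<open>p\<close>, and it is there that the
  symmetry of \<open>p\<close> would be called for. Hence the Duhamel formula is not obtained by
  exchanging the sub-Laplacean with the integral. Its proof differentiates time integrals that start
  at time 0, where \<open>p\<close> is singular. Therefore every flow is also written, with
  \<open>y = gm x (ginv z)\<close>, as an average of \<open>h (gm x (ginv z))\<close> with weight
  \<open>p z t\<close>: there the space derivatives fall on the test function. Two obstacles follow.
  The definition of \<open>p\<close> gives the Dirac limit only for one fixed test function at a
  time, so continuity in space-time at time 0 needs a bound on the local mass of \<open>p\<close>
  for small times. And the substitution needs the left invariance of Lebesgue measure, which is not
  an axiom of the locale and is derived from the dilations.\<close>

lemma Ck_on_cong:
  assumes "open S" "\<And>x. x \<in> S \<Longrightarrow> f x = g x" "Ck_on k S f"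
  shows "Ck_on k S g"
  using assms(2,3)
proof (induction k arbitrary: f g)
  case 0
  then show ?case using continuous_on_cong[of S S f g] by simp
next
  case (Suc k)
  have ev: "eventually (\<lambda>y. f y = g y) (nhds x)" if "x \<in> S" for x
    using eventually_nhds_in_open[OF assms(1) that] by eventually_elim (use Suc in auto)
  have hd: "(f has_derivative D) (at x) \<longleftrightarrow> (g has_derivative D) (at x)" if "x \<in> S" for x D
    using has_derivative_transform_eventually[of f D x UNIV g] has_derivative_transform_eventually[of g D x UNIV f]
      eventually_mono[OF ev[OF that]] eventually_nhds_x_imp_x[OF ev[OF that]]
    by (auto simp: eventually_at_filter)
  \<comment> \<open>\<open>frechet_derivative\<close> is a choice made from the
    \<open>has_derivative\<close> predicate alone, so equal predicates give equal choices.\<close>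
  have fd: "frechet_derivative f (at x) = frechet_derivative g (at x)" if "x \<in> S" for x
    unfolding frechet_derivative_def hd[OF that] ..
  have "g differentiable (at x)" if "x \<in> S" for x
    using Suc.prems(2) that unfolding Ck_on.simps differentiable_def hd[OF that, symmetric] by blast
  moreover have "Ck_on k S (\<lambda>x. frechet_derivative g (at x) v)" for v
    by (rule Suc.IH[of "\<lambda>x. frechet_derivative f (at x) v"]) (use fd Suc.prems(2) in auto)
  ultimately show ?case by simp
qed

text \<open>The calculus rules deliver derivatives as explicit formulas; this lets such a formula
  replace the choice \<open>frechet_derivative\<close> in the inductions on the order.\<close>

lemma Ck_on_SucI:
  assumes "open S" "\<And>x. x \<in> S \<Longrightarrow> (f has_derivative f' x) (at x)"
    "\<And>v. Ck_on k S (\<lambda>x. f' x v)"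
  shows "Ck_on (Suc k) S f"
proof -
  have "frechet_derivative f (at x) = f' x" if "x \<in> S" for x
    using frechet_derivative_at[OF assms(2)[OF that]] by simp
  then have "Ck_on k S (\<lambda>x. frechet_derivative f (at x) v)" for v
    by (intro Ck_on_cong[OF assms(1) _ assms(3)[of v]]) auto
  then show ?thesis using assms(2) by (auto simp: differentiable_def)
qed

lemma Ck_on_SucD: "Ck_on (Suc k) S f \<Longrightarrow> Ck_on k S f"
proof (induction k arbitrary: f)
  case 0
  then show ?case
    by (auto intro!: continuous_at_imp_continuous_on differentiable_imp_continuous_within)
next
  case (Suc k)
  then show ?case by simp
qed

lemma Ck_on_has_derivative:
  "Ck_on (Suc k) S f \<Longrightarrow> x \<in> S \<Longrightarrow> (f has_derivative frechet_derivative f (at x)) (at x)"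
  by (simp add: frechet_derivative_works)

lemma Ck_on_const [simp]: "open S \<Longrightarrow> Ck_on k S (\<lambda>x. c)"
proof (induction k arbitrary: c)
  case (Suc k)
  then show ?case by (intro Ck_on_SucI[where f' = "\<lambda>x v. 0"]) auto
qed auto

lemma Ck_on_linear_comp:
  assumes "bounded_linear L" "open S" "Ck_on k S f"
  shows "Ck_on k S (\<lambda>x. L (f x))"
  using assms(3)
proof (induction k arbitrary: f)
  case 0
  then show ?case using bounded_linear.continuous_on[OF assms(1)] by auto
next
  case (Suc k)
  show ?case
    by (rule Ck_on_SucI[OF assms(2) bounded_linear.has_derivative[OF assms(1) Ck_on_has_derivative[OF Suc.prems]]])
      (use Suc in auto)
qed

lemma Ck_on_linear:
  assumes "bounded_linear L" "open S"
  shows "Ck_on k S L"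
proof -
  have "Ck_on k S (\<lambda>x. x)"
  proof (cases k)
    case (Suc j)
    then show ?thesis using assms by (auto intro!: Ck_on_SucI[where f' = "\<lambda>x v. v"])
  qed auto
  from Ck_on_linear_comp[OF assms this] show ?thesis .
qed

lemma Ck_on_add:
  assumes "open S" "Ck_on k S f" "Ck_on k S g"
  shows "Ck_on k S (\<lambda>x. f x + g x)"
  using assms(2,3)
proof (induction k arbitrary: f g)
  case 0
  then show ?case by (auto intro: continuous_on_add)
next
  case (Suc k)
  show ?case
    by (rule Ck_on_SucI[OF assms(1) has_derivative_add])
      (use Suc in \<open>auto intro: Ck_on_has_derivative\<close>)
qed

lemma Ck_on_sum:
  assumes "open S" "\<And>i. i \<in> I \<Longrightarrow> Ck_on k S (f i)"
  shows "Ck_on k S (\<lambda>x. \<Sum>i\<in>I. f i x)"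
  using assms(2)
  by (induction I rule: infinite_finite_induct) (auto intro: Ck_on_add simp: assms(1))

lemma Ck_on_scaleR:
  assumes "open S" "Ck_on k S f" "Ck_on k S g"
  shows "Ck_on k S (\<lambda>x. f x *\<^sub>R g x)"
  using assms(2,3)
proof (induction k arbitrary: f g)
  case 0
  then show ?case by (auto intro: continuous_on_scaleR)
next
  case (Suc k)
  have *: "Ck_on k S (\<lambda>x. f x *\<^sub>R frechet_derivative g (at x) v + frechet_derivative f (at x) v *\<^sub>R g x)" for v
    by (rule Ck_on_add[OF assms(1) Suc.IH Suc.IH])
      (use Suc.prems Ck_on_SucD[OF Suc.prems(1)] Ck_on_SucD[OF Suc.prems(2)] in auto)
  show ?case
    by (rule Ck_on_SucI[OF assms(1) has_derivative_scaleR *])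
      (use Suc.prems in \<open>auto intro: Ck_on_has_derivative\<close>)
qed

text \<open>In the chain rule the direction \<open>frechet_derivative g (at x) v\<close> varies with
  \<open>x\<close>, while \<open>Ck_on\<close> speaks of fixed directions only. Expanding it in the
  basis leaves finitely many fixed directions, with coefficients covered by the hypothesis on
  \<open>g\<close>.\<close>

lemma Ck_on_compose:
  fixes g :: "'a::real_normed_vector \<Rightarrow> 'b::euclidean_space"
  assumes "open S" "open T" "Ck_on k T f" "Ck_on k S g" "g ` S \<subseteq> T"
  shows "Ck_on k S (\<lambda>x. f (g x))"
  using assms(3,4)
proof (induction k arbitrary: f)
  case 0
  then show ?case using assms(5) by (auto intro: continuous_on_compose2)
next
  case (Suc k)
  let ?D = "\<lambda>x v. frechet_derivative f (at (g x)) (frechet_derivative g (at x) v)"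
  have gk: "Ck_on k S (\<lambda>x. frechet_derivative g (at x) v)" for v
    using Suc.prems by auto
  have eq: "(\<Sum>b\<in>Basis. (frechet_derivative g (at x) v \<bullet> b) *\<^sub>R frechet_derivative f (at (g x)) b) = ?D x v"
    if "x \<in> S" for x v
  proof -
    have "g x \<in> T" using that assms(5) by auto
    then have "linear (frechet_derivative f (at (g x)))"
      using Suc.prems(1) by (auto intro!: linear_frechet_derivative)
    note lin = this
    have "?D x v = frechet_derivative f (at (g x)) (\<Sum>b\<in>Basis. (frechet_derivative g (at x) v \<bullet> b) *\<^sub>R b)"
      by (simp only: euclidean_representation)
    also have "\<dots> = (\<Sum>b\<in>Basis. (frechet_derivative g (at x) v \<bullet> b) *\<^sub>R frechet_derivative f (at (g x)) b)"
      unfolding linear_sum[OF lin] linear_cmul[OF lin] ..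
    finally show ?thesis by simp
  qed
  have *: "Ck_on k S (\<lambda>x. \<Sum>b\<in>Basis. (frechet_derivative g (at x) v \<bullet> b) *\<^sub>R frechet_derivative f (at (g x)) b)" for v
    by (intro Ck_on_sum Ck_on_scaleR assms(1) Suc.IH
          Ck_on_linear_comp[OF bounded_linear_inner_left assms(1) gk])
      (use Suc.prems Ck_on_SucD[OF Suc.prems(2)] in auto)
  have **: "Ck_on k S (\<lambda>x. ?D x v)" for v
    by (rule Ck_on_cong[OF assms(1) _ *]) (use eq in auto)
  have "((\<lambda>x. f (g x)) has_derivative ?D x) (at x)" if "x \<in> S" for x
    by (rule has_derivative_compose[OF Ck_on_has_derivative[OF Suc.prems(2) that] Ck_on_has_derivative[OF Suc.prems(1)]])
      (use that assms(5) in auto)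
  from Ck_on_SucI[OF assms(1) this **] show ?case by simp
qed

lemma Ck_on_Pair:
  assumes "open S" "Ck_on k S f" "Ck_on k S g"
  shows "Ck_on k S (\<lambda>x. (f x, g x))"
proof -
  have 1: "bounded_linear (\<lambda>x. (x, 0))" and 2: "bounded_linear (\<lambda>x. (0, x))"
    by (auto intro!: bounded_linear_Pair bounded_linear_ident bounded_linear_zero)
  from Ck_on_add[OF assms(1) Ck_on_linear_comp[OF 1 assms(1,2)] Ck_on_linear_comp[OF 2 assms(1,3)]]
  show ?thesis by simp
qed

section \<open>Closure properties of \<open>smooth_on\<close>\<close>

lemma smooth_on_linear: "bounded_linear L \<Longrightarrow> open S \<Longrightarrow> smooth_on S L"
  by (auto simp: smooth_on_def intro: Ck_on_linear)

lemma smooth_on_const: "open S \<Longrightarrow> smooth_on S (\<lambda>x. c)"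
  by (auto simp: smooth_on_def)

lemma smooth_on_add: "open S \<Longrightarrow> smooth_on S f \<Longrightarrow> smooth_on S g \<Longrightarrow> smooth_on S (\<lambda>x. f x + g x)"
  by (auto simp: smooth_on_def intro: Ck_on_add)

lemma smooth_on_sum:
  "open S \<Longrightarrow> (\<And>i. i \<in> I \<Longrightarrow> smooth_on S (f i)) \<Longrightarrow> smooth_on S (\<lambda>x. \<Sum>i\<in>I. f i x)"
  by (auto simp: smooth_on_def intro: Ck_on_sum)

lemma smooth_on_scaleR:
  "open S \<Longrightarrow> smooth_on S f \<Longrightarrow> smooth_on S g \<Longrightarrow> smooth_on S (\<lambda>x. f x *\<^sub>R g x)"
  by (auto simp: smooth_on_def intro: Ck_on_scaleR)

lemma smooth_on_mult:
  fixes f g :: "_ \<Rightarrow> real"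
  shows "open S \<Longrightarrow> smooth_on S f \<Longrightarrow> smooth_on S g \<Longrightarrow> smooth_on S (\<lambda>x. f x * g x)"
  using smooth_on_scaleR[of S f g] by simp

lemma smooth_on_compose:
  fixes g :: "'a::real_normed_vector \<Rightarrow> 'b::euclidean_space"
  shows "open S \<Longrightarrow> open T \<Longrightarrow> smooth_on T f \<Longrightarrow> smooth_on S g \<Longrightarrow> g ` S \<subseteq> T \<Longrightarrow> smooth_on S (\<lambda>x. f (g x))"
  by (auto simp: smooth_on_def intro: Ck_on_compose)

lemma smooth_on_Pair:
  "open S \<Longrightarrow> smooth_on S f \<Longrightarrow> smooth_on S g \<Longrightarrow> smooth_on S (\<lambda>x. (f x, g x))"
  by (auto simp: smooth_on_def intro: Ck_on_Pair)

lemma smooth_on_frechet: "smooth_on S f \<Longrightarrow> smooth_on S (\<lambda>x. frechet_derivative f (at x) v)"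
  unfolding smooth_on_def using Ck_on.simps(2) by blast

lemma smooth_on_imp_continuous_on: "smooth_on S f \<Longrightarrow> continuous_on S f"
  unfolding smooth_on_def using Ck_on.simps(1) by blast

lemma smooth_on_has_derivative:
  "smooth_on S f \<Longrightarrow> x \<in> S \<Longrightarrow> (f has_derivative frechet_derivative f (at x)) (at x)"
  unfolding smooth_on_def using Ck_on_has_derivative by blast

lemma smooth_on_cong:
  "open S \<Longrightarrow> (\<And>x. x \<in> S \<Longrightarrow> f x = g x) \<Longrightarrow> smooth_on S f \<Longrightarrow> smooth_on S g"
  unfolding smooth_on_def using Ck_on_cong by blast

subsection \<open>Bump functions\<close>

text \<open>The factor \<open>(1 / x) ^ k\<close> makes the family closed under differentiation up
  to linear combinations, so smoothness of the classical flat function (\<open>k = 0\<close>)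
  follows by induction on the order, for all \<open>k\<close> at once.\<close>

definition flat_exp :: "nat \<Rightarrow> real \<Rightarrow> real" where
  "flat_exp k x = (if x > 0 then (1 / x) ^ k * exp (- (1 / x)) else 0)"

lemma flat_exp_tendsto: "(flat_exp k \<longlongrightarrow> 0) (at 0)"
proof -
  have "((\<lambda>y::real. y ^ k / exp y) \<longlongrightarrow> 0) at_top" by (rule tendsto_power_div_exp_0)
  then have "((\<lambda>x::real. (inverse x) ^ k / exp (inverse x)) \<longlongrightarrow> 0) (at_right 0)"
    by (rule filterlim_compose[OF _ filterlim_inverse_at_top_right])
  then have "(flat_exp k \<longlongrightarrow> 0) (at_right 0)"
    by (rule Lim_transform_eventually)
      (auto simp: eventually_at_filter flat_exp_def field_simps exp_minus intro!: always_eventually)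
  moreover have "(flat_exp k \<longlongrightarrow> 0) (at_left 0)"
    by (rule tendsto_eventually) (auto simp: eventually_at_filter flat_exp_def)
  ultimately show ?thesis by (simp add: filterlim_at_split)
qed

lemma flat_exp_deriv:
  "(flat_exp k has_real_derivative (flat_exp (k + 2) x - real k * flat_exp (k + 1) x)) (at x)"
proof (cases "x = 0")
  case True
  \<comment> \<open>The difference quotient of \<open>flat_exp k\<close> at 0 is
    \<open>flat_exp (k + 1)\<close>.\<close>
  have "((\<lambda>h. (flat_exp k (0 + h) - flat_exp k 0) / h) \<longlongrightarrow> 0) (at 0)"
    by (rule Lim_transform_eventually[OF flat_exp_tendsto[of "k + 1"]])
      (auto simp: eventually_at_filter flat_exp_def)
  then show ?thesis using True by (simp add: DERIV_def) (simp add: flat_exp_def)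
next
  case False
  show ?thesis
  proof (cases "x > 0")
    case True
    have "((\<lambda>y. y ^ k * exp (- y)) has_real_derivative
        real k * y ^ (k - 1) * exp (- y) - y ^ k * exp (- y)) (at y)" for y :: real
      by (auto intro!: derivative_eq_intros)
    moreover have "((\<lambda>x. 1 / x) has_real_derivative - ((1 / x)\<^sup>2)) (at x)"
      using True by (auto intro!: derivative_eq_intros simp: power2_eq_square)
    ultimately have "((\<lambda>x. (1 / x) ^ k * exp (- (1 / x))) has_real_derivative
        (real k * (1 / x) ^ (k - 1) * exp (- (1 / x)) - (1 / x) ^ k * exp (- (1 / x))) * - ((1 / x)\<^sup>2)) (at x)"
      by (rule DERIV_chain2)
    also have "(real k * (1 / x) ^ (k - 1) * exp (- (1 / x)) - (1 / x) ^ k * exp (- (1 / x))) * - ((1 / x)\<^sup>2)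
        = flat_exp (k + 2) x - real k * flat_exp (k + 1) x"
      unfolding flat_exp_def using True
      by (cases k) (simp_all add: field_simps power2_eq_square)
    finally have "((\<lambda>x. (1 / x) ^ k * exp (- (1 / x))) has_real_derivative
        flat_exp (k + 2) x - real k * flat_exp (k + 1) x) (at x)" .
    then show ?thesis
      by (rule has_field_derivative_transform_within_open[of _ _ _ "{0<..}"])
        (use True in \<open>auto simp: flat_exp_def\<close>)
  next
    case nle: False
    have "((\<lambda>x. 0) has_real_derivative 0) (at x)" by simp
    then have "(flat_exp k has_real_derivative 0) (at x)"
      by (rule has_field_derivative_transform_within_open[of _ _ _ "{..<0}"])
        (use nle False in \<open>auto simp: flat_exp_def\<close>)
    then show ?thesis using nle by (simp add: flat_exp_def)
  qed
qed

lemma Ck_on_flat_exp: "Ck_on j UNIV (flat_exp k)"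
proof (induction j arbitrary: k)
  case 0
  then show ?case
    using flat_exp_deriv by (auto intro!: continuous_at_imp_continuous_on DERIV_isCont)
next
  case (Suc j)
  have *: "Ck_on j UNIV (\<lambda>x. v *\<^sub>R flat_exp (k + 2) x + (- v * real k) *\<^sub>R flat_exp (k + 1) x)" for v :: real
    by (intro Ck_on_add Ck_on_scaleR Suc) auto
  have **: "Ck_on j UNIV (\<lambda>x. (flat_exp (k + 2) x - real k * flat_exp (k + 1) x) * v)" for v :: real
    by (rule Ck_on_cong[OF _ _ *[of v]]) (auto simp: algebra_simps)
  then show ?case
    using flat_exp_deriv[of k]
    by (intro Ck_on_SucI[OF _ _ **]) (auto simp: has_field_derivative_def)
qed

lemma test_fun_support:
  assumes "test_fun h" obtains K where "compact K" "\<And>x. x \<notin> K \<Longrightarrow> h x = 0"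
proof -
  have "h x = 0" if "x \<notin> closure {x. h x \<noteq> 0}" for x
    using that closure_subset[of "{x. h x \<noteq> 0}"] by auto
  then show thesis using that assms unfolding test_fun_def by blast
qed

lemma test_funI:
  fixes h :: "'a::real_normed_vector \<Rightarrow> real"
  assumes "smooth_on UNIV h" "compact K" "\<And>x. x \<notin> K \<Longrightarrow> h x = 0"
  shows "test_fun h"
proof -
  have "closure {x. h x \<noteq> 0} \<subseteq> K"
    using assms by (intro closure_minimal) (auto intro: compact_imp_closed)
  then have "compact (closure {x. h x \<noteq> 0})"
    using compact_Int_closed[OF assms(2), of "closure {x. h x \<noteq> 0}"] by (simp add: inf.absorb2)
  then show ?thesis using assms(1) by (simp add: test_fun_def)
qed

lemma bump_fun_exists:
  fixes K :: "'a::euclidean_space set"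
  assumes "compact K"
  obtains \<phi> where "test_fun \<phi>" "\<And>x. 0 \<le> \<phi> x" "\<And>x. x \<in> K \<Longrightarrow> 1 \<le> \<phi> x"
proof -
  obtain R where R: "R > 0" "\<And>x. x \<in> K \<Longrightarrow> norm x \<le> R"
    using compact_imp_bounded[OF assms] bounded_pos by metis
  \<comment> \<open>For \<open>norm x \<le> R\<close> the argument of \<open>flat_exp 0\<close> is
    at least 1, so its value is at least \<open>exp (- 1)\<close>, which the factor
    \<open>exp 1\<close> lifts to 1. Outside the ball of radius \<open>R + 1\<close> the argument is
    not positive.\<close>
  define \<phi> where "\<phi> = (\<lambda>x::'a. exp 1 * flat_exp 0 (R\<^sup>2 + 1 + (- 1) * (x \<bullet> x)))"
  have "smooth_on UNIV (\<lambda>x::'a. \<Sum>b\<in>Basis. (x \<bullet> b) * (x \<bullet> b))"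
    by (intro smooth_on_sum smooth_on_mult smooth_on_linear bounded_linear_inner_left) auto
  then have "smooth_on UNIV (\<lambda>x::'a. x \<bullet> x)"
    by (rule smooth_on_cong[rotated 2]) (auto simp: euclidean_inner[symmetric])
  then have "smooth_on UNIV (\<lambda>x::'a. R\<^sup>2 + 1 + (- 1) * (x \<bullet> x))"
    by (intro smooth_on_add smooth_on_mult smooth_on_const) auto
  then have "smooth_on UNIV (\<lambda>x::'a. flat_exp 0 (R\<^sup>2 + 1 + (- 1) * (x \<bullet> x)))"
    by (rule smooth_on_compose[OF open_UNIV open_UNIV _ _ subset_UNIV, rotated]) (simp add: smooth_on_def Ck_on_flat_exp)
  then have sm: "smooth_on UNIV \<phi>"
    unfolding \<phi>_def by (rule smooth_on_mult[OF open_UNIV smooth_on_const[OF open_UNIV]])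
  show thesis
  proof
    show "test_fun \<phi>"
    proof (rule test_funI[OF sm compact_cball])
      fix x :: 'a assume "x \<notin> cball 0 (R + 1)"
      then have "(R + 1)\<^sup>2 \<le> norm x ^ 2" using R by (intro power_mono) auto
      then have "R\<^sup>2 + 1 \<le> x \<bullet> x" using R by (simp add: power2_norm_eq_inner power2_sum)
      then show "\<phi> x = 0" by (simp add: \<phi>_def flat_exp_def)
    qed
    show "0 \<le> \<phi> x" for x by (simp add: \<phi>_def flat_exp_def)
    show "1 \<le> \<phi> x" if "x \<in> K" for x
    proof -
      have "norm x ^ 2 \<le> R\<^sup>2" using R that by (intro power_mono) auto
      then have ge: "R\<^sup>2 + 1 + (- 1) * (x \<bullet> x) \<ge> 1" by (simp add: power2_norm_eq_inner)
      then have "1 / (R\<^sup>2 + 1 + (- 1) * (x \<bullet> x)) \<le> 1" by simp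
      then have "exp 0 \<le> exp (1 + - (1 / (R\<^sup>2 + 1 + (- 1) * (x \<bullet> x))))" by (subst exp_le_cancel_iff) simp
      then show ?thesis using ge by (simp only: \<phi>_def flat_exp_def exp_add) simp
    qed
  qed
qed

section \<open>Left invariance of Lebesgue measure\<close>

text \<open>The change of variables theorem of the library needs a well-ordered index type, hence a copy
  of the index type that carries an arbitrary well-order.\<close>

typedef 'a wo = "UNIV :: 'a set" morphisms unwo wo by auto

lemma wo_inverses [simp]: "unwo (wo x) = x" "wo (unwo k) = k"
  by (auto simp: wo_inverse unwo_inverse)

lemma bij_unwo: "bij unwo"
  by (rule bijI) (auto simp: inj_def unwo_inject surj_def intro: exI[of _ "wo _"])

definition wo_rank :: "'a::finite \<Rightarrow> nat" where "wo_rank = (SOME f. inj f)"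

lemma wo_rank_inject [simp]: "wo_rank x = wo_rank y \<longleftrightarrow> x = y"
proof -
  have "\<exists>f :: 'a \<Rightarrow> nat. inj f"
    using finite_imp_inj_to_nat_seg[of "UNIV :: 'a set"] by auto
  then have "inj (wo_rank :: 'a \<Rightarrow> nat)" unfolding wo_rank_def by (rule someI_ex)
  then show ?thesis by (auto dest: injD)
qed

instance wo :: (finite) finite
proof
  have "(UNIV :: 'a wo set) = range wo" by (metis surj_def wo_inverses(2))
  then show "finite (UNIV :: 'a wo set)" by (metis finite finite_imageI)
qed

instantiation wo :: (finite) wellorder
begin

definition less_eq_wo :: "'a wo \<Rightarrow> 'a wo \<Rightarrow> bool" where
  "less_eq_wo x y \<longleftrightarrow> wo_rank (unwo x) \<le> wo_rank (unwo y)"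

definition less_wo :: "'a wo \<Rightarrow> 'a wo \<Rightarrow> bool" where
  "less_wo x y \<longleftrightarrow> wo_rank (unwo x) < wo_rank (unwo y)"

instance
proof
  fix P :: "'a wo \<Rightarrow> bool" and a :: "'a wo"
  assume step: "\<And>x. (\<And>y. y < x \<Longrightarrow> P y) \<Longrightarrow> P x"
  show "P a"
    by (induction a rule: measure_induct_rule[of "\<lambda>x. wo_rank (unwo x)"])
      (auto intro: step simp: less_wo_def)
qed (auto simp: less_eq_wo_def less_wo_def unwo_inject)

end

text \<open>The preimage of a box under \<open>h\<close> is its image under \<open>g\<close>, which
  has the volume of the box by change of variables; boxes determine Lebesgue measure.\<close>

lemma lborel_eq_distr_unimodular:
  fixes g h :: "real^'m::{finite,wellorder} \<Rightarrow> real^'m::_"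
  assumes der: "\<And>x. (g has_derivative g' x) (at x)" and det: "\<And>x. det (matrix (g' x)) = 1"
    and inv: "\<And>x. h (g x) = x" "\<And>x. g (h x) = x" and h: "h \<in> borel_measurable borel"
  shows "distr lborel borel h = lborel"
proof (rule lborel_eqI[symmetric])
  fix l u :: "real^'m::_" assume le: "\<And>b. b \<in> Basis \<Longrightarrow> l \<bullet> b \<le> u \<bullet> b"
  have img: "h -` box l u = g ` box l u" 
    by (auto simp: inv(1)) (metis imageI inv(2))
  have "inj_on g (box l u)" using inv(1) by (metis inj_onI)
  moreover have "((\<lambda>x. 1 :: real) has_integral (\<Prod>b\<in>Basis. (u - l) \<bullet> b)) (box l u)"
  proof -
    have "cbox l u \<noteq> {}" using le by (simp add: box_ne_empty)
    then show ?thesis using has_integral_const[of "1 :: real" l u]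
      by (simp add: content_cbox_if inner_diff_left has_integral_open_interval)
  qed
  ultimately have "g ` box l u \<in> lmeasurable \<and> measure lebesgue (g ` box l u) = (\<Prod>b\<in>Basis. (u - l) \<bullet> b)"
    using has_measure_differentiable_image[of "box l u" g g' "\<Prod>b\<in>Basis. (u - l) \<bullet> b"] det
    by (auto intro: has_derivative_at_withinI[OF der])
  moreover have "g ` box l u \<in> sets lborel"
    using measurable_sets[OF h, of "box l u"] by (simp add: img)
  ultimately have "emeasure lborel (g ` box l u) = (\<Prod>b\<in>Basis. (u - l) \<bullet> b)"
    using emeasure_eq_measure2[of "g ` box l u" lebesgue] by simp
  then show "emeasure (distr lborel borel h) (box l u) = (\<Prod>b\<in>Basis. (u - l) \<bullet> b)"
    using h by (simp add: emeasure_distr img)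
qed simp

section \<open>Dilations and the Jacobian of left translations\<close>

lemma dil_linear: "linear (dil \<sigma> r)"
  by (rule linearI) (simp_all add: dil_def vec_eq_iff algebra_simps)

lemma bounded_linear_dil: "bounded_linear (dil \<sigma> r :: real^'n \<Rightarrow> real^'n)"
  by (simp add: dil_linear linear_linear)

lemma dil_inverse: "r \<noteq> 0 \<Longrightarrow> dil \<sigma> r (dil \<sigma> (1 / r) x) = x" "r \<noteq> 0 \<Longrightarrow> dil \<sigma> (1 / r) (dil \<sigma> r x) = x"
  by (simp_all add: dil_def vec_eq_iff power_one_over)

lemma dil_tendsto_0:
  assumes "\<And>i. \<sigma> i \<ge> 1"
  shows "((\<lambda>r. dil \<sigma> r x) \<longlongrightarrow> 0) (at_right 0)"
proof -
  have "((\<lambda>r. r ^ \<sigma> i * x $ i) \<longlongrightarrow> 0 ^ \<sigma> i * x $ i) (at_right 0)" for i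
    by (intro tendsto_intros)
  moreover have "0 ^ \<sigma> i * x $ i = 0" for i using assms[of i] by (simp add: power_0_left)
  ultimately show ?thesis by (intro vec_tendstoI) (simp add: dil_def)
qed

text \<open>The Jacobian determinant of left translation by \<open>a\<close> at the identity is invariant under the
  dilations of \<open>a\<close>, and these contract \<open>a\<close> to the identity, where the determinant is 1.\<close>

lemma lborel_left_invariant_wo:
  fixes gm :: "real^'m::{finite,wellorder} \<Rightarrow> real^'m::_ \<Rightarrow> real^'m::_"
  assumes sm: "smooth_on UNIV (\<lambda>(x, y). gm x y)"
    and assoc: "\<And>x y z. gm (gm x y) z = gm x (gm y z)"
    and unit: "\<And>x. gm 0 x = x" "\<And>x. gm x 0 = x"
    and inv: "\<And>x. gm (gi x) x = 0" "\<And>x. gm x (gi x) = 0"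
    and dil: "\<And>r x y. r > 0 \<Longrightarrow> dil \<sigma> r (gm x y) = gm (dil \<sigma> r x) (dil \<sigma> r y)"
    and deg: "\<And>i. \<sigma> i \<ge> 1"
  shows "distr lborel borel (gm a) = lborel"
proof -
  let ?G = "\<lambda>(x, y). gm x y"
  define D where "D = (\<lambda>a b v. frechet_derivative ?G (at (a, b)) (0, v))"
  have D: "(gm a has_derivative D a b) (at b)" for a b
  proof -
    have "((\<lambda>y. (a, y)) has_derivative (\<lambda>v. (0, v))) (at b)"
      by (auto intro!: derivative_eq_intros)
    from has_derivative_compose[OF this smooth_on_has_derivative[OF sm]] show ?thesis
      by (simp add: D_def)
  qed
  have linD: "linear (D a b)" for a b by (rule has_derivative_linear[OF D])
  define M where "M = (\<lambda>a b. det (matrix (D a b)))"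
  \<comment> \<open>The chain rule for \<open>gm a (gm b y) = gm (gm a b) y\<close> at
    \<open>y = 0\<close>.\<close>
  have chain: "M (gm a b) 0 = M a b * M b 0" for a b
  proof -
    have "((\<lambda>y. gm a (gm b y)) has_derivative (\<lambda>v. D a b (D b 0 v))) (at 0)"
      using has_derivative_compose[OF D[of b 0], of "gm a" "D a b"] D[of a b] by (simp add: unit)
    moreover have "(\<lambda>y. gm a (gm b y)) = gm (gm a b)" using assoc by auto
    ultimately have "D (gm a b) 0 = D a b \<circ> D b 0"
      using has_derivative_unique[OF D[of "gm a b" 0]] by (auto simp: o_def)
    then show ?thesis
      by (simp add: M_def matrix_compose[OF linD linD] det_mul)
  qed
  \<comment> \<open>The dilation intertwines translation by \<open>a\<close> with translation by the
    dilated point; its nonzero determinant appears on both sides and cancels.\<close>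
  have dilM: "M (dil \<sigma> r a) 0 = M a 0" if "r > 0" for r a
  proof -
    have dd: "(dil \<sigma> r has_derivative dil \<sigma> r) (at x)" for x :: "real^'m::{finite,wellorder}"
      by (rule bounded_linear_imp_has_derivative[OF bounded_linear_dil])
    have d0: "dil \<sigma> r 0 = (0 :: real^'m::{finite,wellorder})" by (simp add: dil_def vec_eq_iff)
    have 1: "((\<lambda>y. gm (dil \<sigma> r a) (dil \<sigma> r y)) has_derivative (\<lambda>v. D (dil \<sigma> r a) 0 (dil \<sigma> r v))) (at 0)"
      using has_derivative_compose[OF dd[of 0], of "gm (dil \<sigma> r a)"] D[of "dil \<sigma> r a" 0] d0 by simp
    have 2: "((\<lambda>y. dil \<sigma> r (gm a y)) has_derivative (\<lambda>v. dil \<sigma> r (D a 0 v))) (at 0)"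
      by (rule has_derivative_compose[OF D dd])
    have 3: "(\<lambda>y. gm (dil \<sigma> r a) (dil \<sigma> r y)) = (\<lambda>y. dil \<sigma> r (gm a y))"
      using dil[OF that] by auto
    have "D (dil \<sigma> r a) 0 \<circ> dil \<sigma> r = dil \<sigma> r \<circ> D a 0"
      unfolding o_def by (rule has_derivative_unique[OF 1[unfolded 3] 2])
    then have "matrix (D (dil \<sigma> r a) 0) ** matrix (dil \<sigma> r) = matrix (dil \<sigma> r) ** matrix (D a 0)"
      by (simp add: matrix_compose[OF dil_linear linD, symmetric] matrix_compose[OF linD dil_linear, symmetric])
    then have "M (dil \<sigma> r a) 0 * det (matrix (dil \<sigma> r :: real^'m::{finite,wellorder} \<Rightarrow> _)) = det (matrix (dil \<sigma> r :: real^'m::{finite,wellorder} \<Rightarrow> _)) * M a 0"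
      unfolding M_def by (simp add: det_mul[symmetric])
    moreover have "matrix (dil \<sigma> r :: real^'m::{finite,wellorder} \<Rightarrow> _) ** matrix (dil \<sigma> (1 / r)) = mat 1"
      using dil_inverse(1)[of r \<sigma>] that
      by (subst matrix_compose[symmetric]) (auto simp: dil_linear o_def matrix_id_mat_1[unfolded id_def])
    then have "det (matrix (dil \<sigma> r :: real^'m::{finite,wellorder} \<Rightarrow> _)) \<noteq> 0"
      by (metis det_I det_mul mult_zero_left zero_neq_one)
    ultimately show ?thesis by simp
  qed
  have M0: "M 0 0 = 1"
  proof -
    have "gm 0 = (\<lambda>x. x)" using unit by auto
    then have "D 0 0 = id"
      using has_derivative_unique[OF D[of 0 0]] has_derivative_ident[of "at 0"] by (auto simp: id_def)
    then show ?thesis by (simp add: M_def matrix_id_mat_1)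
  qed
  have contM: "continuous_on UNIV (\<lambda>a. M a 0)"
  proof -
    have "continuous_on UNIV (\<lambda>a. D a 0 v)" for v
      unfolding D_def
      by (rule continuous_on_compose2[OF smooth_on_imp_continuous_on[OF smooth_on_frechet[OF sm]]])
        (auto intro!: continuous_intros)
    then show ?thesis
      unfolding M_def det_def matrix_def by (auto intro!: continuous_intros)
  qed
  have M1: "M a 0 = 1" for a
  proof -
    have "((\<lambda>r. M (dil \<sigma> r a) 0) \<longlongrightarrow> M 0 0) (at_right 0)"
      using contM by (intro isCont_tendsto_compose[OF _ dil_tendsto_0[OF deg]])
        (auto simp: continuous_on_eq_continuous_at)
    moreover have "((\<lambda>r. M (dil \<sigma> r a) 0) \<longlongrightarrow> M a 0) (at_right 0)"
      by (rule tendsto_eventually) (auto simp: eventually_at_filter dilM)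
    ultimately show ?thesis using M0 tendsto_unique trivial_limit_at_right_real by metis
  qed
  have "gm x \<in> borel_measurable borel" for x
    using D by (intro borel_measurable_continuous_onI continuous_at_imp_continuous_on)
      (auto intro: has_derivative_continuous)
  \<comment> \<open>By \<open>chain\<close>, the Jacobian of translation by \<open>gi a\<close> at
    any \<open>b\<close> is a quotient of two Jacobians at the identity, both 1. This translation is
    the diffeomorphism \<open>g\<close> of \<open>lborel_eq_distr_unimodular\<close>, with inverse
    \<open>gm a\<close>.\<close>
  moreover have "det (matrix (D (gi a) b)) = 1" for b
    using chain[of "gi a" b] by (simp add: M1) (simp add: M_def)
  ultimately show ?thesis
    using lborel_eq_distr_unimodular[OF D[of "gi a"], of "gm a"]
    by (simp add: assoc[symmetric] inv unit)
qed

section \<open>Relabelling the coordinates\<close>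

definition to_wo :: "real^'n \<Rightarrow> real^('n wo)" where "to_wo x = (\<chi> k. x $ unwo k)"
definition of_wo :: "real^('n wo) \<Rightarrow> real^'n" where "of_wo x = (\<chi> i. x $ wo i)"

lemma to_of_wo [simp]: "to_wo (of_wo x) = x" "of_wo (to_wo y) = y"
  by (simp_all add: to_wo_def of_wo_def vec_eq_iff)

lemma bounded_linear_to_wo: "bounded_linear to_wo"
  unfolding linear_conv_bounded_linear[symmetric] by (rule linearI) (simp_all add: to_wo_def vec_eq_iff)

lemma bounded_linear_of_wo: "bounded_linear of_wo"
  unfolding linear_conv_bounded_linear[symmetric] by (rule linearI) (simp_all add: of_wo_def vec_eq_iff)

lemma prod_Basis_vec: "(\<Prod>b\<in>(Basis :: (real^'n) set). f b) = (\<Prod>i\<in>UNIV. f (axis i 1) :: real)"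
proof -
  have "(Basis :: (real^'n) set) = range (\<lambda>i. axis i 1)" by (auto simp: Basis_vec_def)
  moreover have "inj (\<lambda>i :: 'n. axis i (1 :: real))" by (auto simp: inj_on_def axis_eq_axis)
  ultimately show ?thesis using prod.reindex[of "\<lambda>i :: 'n. axis i (1 :: real)" UNIV f] by (simp add: o_def)
qed

lemma lborel_distr_of_wo: "distr lborel borel of_wo = (lborel :: (real^'n) measure)"
proof (rule lborel_eqI[symmetric])
  fix l u :: "real^'n" assume "\<And>b. b \<in> Basis \<Longrightarrow> l \<bullet> b \<le> u \<bullet> b"
  then have le: "l $ i \<le> u $ i" for i
    by (metis axis_in_Basis_iff inner_axis real_inner_1_right Basis_real_def insertI1)
  have img: "of_wo -` box l u = box (to_wo l) (to_wo u)"
  proof -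
    have "(\<forall>i. P (wo i)) \<longleftrightarrow> (\<forall>k. P k)" for P :: "'n wo \<Rightarrow> bool" by (metis wo_inverses(2))
    from this[of "\<lambda>k. l $ unwo k < x $ k \<and> x $ k < u $ unwo k" for x]
    show ?thesis by (auto simp: mem_box_cart to_wo_def of_wo_def)
  qed
  have "to_wo l \<bullet> b \<le> to_wo u \<bullet> b" if "b \<in> Basis" for b
    using that le by (auto simp: Basis_vec_def inner_axis to_wo_def)
  then have "emeasure lborel (box (to_wo l) (to_wo u)) = (\<Prod>b\<in>Basis. (to_wo u - to_wo l) \<bullet> b)"
    by (rule emeasure_lborel_box)
  also have "(\<Prod>b\<in>Basis. (to_wo u - to_wo l) \<bullet> b) = (\<Prod>b\<in>Basis. (u - l) \<bullet> b)"
    using prod.reindex_bij_betw[OF bij_unwo, of "\<lambda>i. u $ i - l $ i"]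
    by (simp add: prod_Basis_vec inner_axis to_wo_def)
  finally show "emeasure (distr lborel borel of_wo) (box l u) = (\<Prod>b\<in>Basis. (u - l) \<bullet> b)"
    using linear_continuous_on[OF bounded_linear_of_wo]
    by (subst emeasure_distr) (auto simp: img intro: borel_measurable_continuous_onI)
qed simp

text \<open>The group law is transported to the relabelled coordinates, and the invariance found
  there is carried back because relabelling preserves Lebesgue measure.\<close>

lemma (in carnot_group) lborel_left_invariant: "distr lborel borel (gm a) = lborel"
proof -
  define gm' where "gm' x y = to_wo (gm (of_wo x) (of_wo y))" for x y
  have sm: "smooth_on UNIV (\<lambda>(x, y). gm' x y)"
  proof -
    have "bounded_linear (\<lambda>q. (of_wo (fst q), of_wo (snd q)) :: (real^'n) \<times> (real^'n))"
      by (intro bounded_linear_Pair bounded_linear_compose[OF bounded_linear_of_wo]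
          bounded_linear_fst bounded_linear_snd)
    then have "smooth_on UNIV (\<lambda>q. (\<lambda>(x, y). gm x y) (of_wo (fst q), of_wo (snd q)))"
      by (intro smooth_on_compose[OF open_UNIV open_UNIV smooth_mult] smooth_on_linear) auto
    then have "smooth_on UNIV (\<lambda>q. to_wo ((\<lambda>(x, y). gm x y) (of_wo (fst q), of_wo (snd q))))"
      by (rule smooth_on_compose[OF open_UNIV open_UNIV smooth_on_linear[OF bounded_linear_to_wo open_UNIV]]) auto
    then show ?thesis by (simp add: gm'_def case_prod_beta')
  qed
  have of0: "of_wo 0 = (0 :: real^'n)" by (simp add: of_wo_def vec_eq_iff)
  have to0: "to_wo 0 = (0 :: real^('n wo))" by (simp add: to_wo_def vec_eq_iff)
  have dil': "dil (\<sigma> \<circ> unwo) r x = to_wo (dil \<sigma> r (of_wo x))" for r x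
    by (simp add: dil_def to_wo_def of_wo_def vec_eq_iff)
  have inv: "distr lborel borel (gm' (to_wo a)) = lborel"
    by (rule lborel_left_invariant_wo[OF sm, where \<sigma> = "\<sigma> \<circ> unwo" and gi = "\<lambda>x. to_wo (ginv (of_wo x))"])
      (simp_all add: gm'_def assoc of0 to0 dil' dil_mult degree_pos[simplified])
  have "continuous_on UNIV (\<lambda>y. (\<lambda>(x, y). gm' x y) (to_wo a, y))"
    by (rule continuous_on_compose2[OF smooth_on_imp_continuous_on[OF sm]]) (auto intro!: continuous_intros)
  then have meas: "gm' (to_wo a) \<in> borel_measurable borel"
    by (simp add: borel_measurable_continuous_onI)
  have "continuous_on UNIV (\<lambda>y. (\<lambda>(x, y). gm x y) (a, y))"
    by (rule continuous_on_compose2[OF smooth_on_imp_continuous_on[OF smooth_mult]]) (auto intro!: continuous_intros)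
  then have meas2: "of_wo \<in> borel_measurable borel" "gm a \<in> borel_measurable borel"
    by (simp_all add: borel_measurable_continuous_onI linear_continuous_on[OF bounded_linear_of_wo])
  have "distr lborel borel (gm a) = distr (distr lborel borel of_wo) borel (gm a)"
    by (simp add: lborel_distr_of_wo)
  also have "\<dots> = distr lborel borel (gm a \<circ> of_wo)"
    using meas2 by (intro distr_distr) auto
  also have "gm a \<circ> of_wo = of_wo \<circ> gm' (to_wo a)"
    by (auto simp: gm'_def)
  also have "distr lborel borel (of_wo \<circ> gm' (to_wo a)) = distr (distr lborel borel (gm' (to_wo a))) borel of_wo"
    using meas meas2 by (intro distr_distr[symmetric]) auto
  also have "\<dots> = lborel" by (simp add: inv lborel_distr_of_wo)
  finally show ?thesis .
qed

section \<open>Integrals depending on a parameter\<close>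

text \<open>A bridge from the Lebesgue integral over the whole space to the gauge integral over a
  box, for which parameter continuity and the Leibniz rule are available.\<close>

lemma compact_support_integral:
  fixes f :: "'a::euclidean_space \<Rightarrow> real"
  assumes "continuous_on UNIV f" "\<And>y. y \<notin> cbox a b \<Longrightarrow> f y = 0"
  shows "integrable lborel f" "(LINT y|lborel. f y) = integral (cbox a b) f"
proof -
  have eq: "f = (\<lambda>y. indicator (cbox a b) y *\<^sub>R f y)"
    using assms(2) by (auto simp: indicator_def fun_eq_iff)
  have c: "continuous_on (cbox a b) f" using assms(1) continuous_on_subset by blast
  have si: "set_integrable lborel (cbox a b) f"
    by (rule borel_integrable_compact[OF compact_cbox c, folded set_integrable_def])
  then show "integrable lborel f" using eq unfolding set_integrable_def by simp
  have "(LINT y|lborel. f y) = (LINT y:cbox a b|lborel. f y)"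
    using eq unfolding set_lebesgue_integral_def by simp
  also have "\<dots> = integral (cbox a b) f" by (rule set_borel_integral_eq_integral(2)[OF si])
  finally show "(LINT y|lborel. f y) = integral (cbox a b) f" .
qed

text \<open>The support of a translate \<open>h (gm x (ginv z))\<close> in \<open>z\<close> moves
  with \<open>x\<close>, so no single compact set serves all parameters. A compact set that serves
  all nearby parameters is enough for continuity and differentiation under the integral.\<close>

definition loc_supp :: "'s::topological_space set \<Rightarrow> ('s \<times> 'a::topological_space \<Rightarrow> real) \<Rightarrow> bool" where
  "loc_supp S F \<longleftrightarrow> (\<forall>s\<in>S. \<exists>T K. open T \<and> s \<in> T \<and> compact K \<and> (\<forall>s'\<in>T. \<forall>y. y \<notin> K \<longrightarrow> F (s', y) = 0))"

lemma loc_suppE: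
  assumes "loc_supp S F" "s \<in> S"
  obtains T K where "open T" "s \<in> T" "compact K" "\<And>s' y. s' \<in> T \<Longrightarrow> y \<notin> K \<Longrightarrow> F (s', y) = 0"
proof -
  obtain T K where "open T" "s \<in> T" "compact K" "\<forall>s'\<in>T. \<forall>y. y \<notin> K \<longrightarrow> F (s', y) = 0"
    using bspec[OF assms(1)[unfolded loc_supp_def] assms(2)] by (elim exE conjE)
  then show thesis by (intro that[of T K]) auto
qed

lemma loc_supp_mult: "loc_supp S F \<Longrightarrow> loc_supp S (\<lambda>q. G q * F q)"
  unfolding loc_supp_def by (metis mult_zero_right)

text \<open>The partial derivative in the real variable, taken as a directional derivative of the
  joint function so that it inherits smoothness and can be iterated.\<close>

definition deriv_fst :: "(real \<times> 'a::real_normed_vector \<Rightarrow> real) \<Rightarrow> real \<times> 'a \<Rightarrow> real" where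
  "deriv_fst F q = frechet_derivative F (at q) (1, 0)"

lemma smooth_on_deriv_fst: "smooth_on S F \<Longrightarrow> smooth_on S (deriv_fst F)"
  unfolding deriv_fst_def[abs_def] by (rule smooth_on_frechet)

lemma has_derivative_deriv_fst:
  assumes "(F has_derivative F') (at (s, y))"
  shows "((\<lambda>s. F (s, y)) has_real_derivative deriv_fst F (s, y)) (at s)"
proof -
  have F': "frechet_derivative F (at (s, y)) = F'"
    by (rule frechet_derivative_at[OF assms, symmetric])
  have "((\<lambda>s. (s, y)) has_derivative (\<lambda>h. (h, 0))) (at s)"
    by (intro has_derivative_Pair has_derivative_ident has_derivative_const)
  from has_derivative_compose[OF this assms]
  have "((\<lambda>s. F (s, y)) has_derivative (\<lambda>h. F' (h, 0))) (at s)" .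
  moreover have "F' (h, 0) = F' (1, 0) * h" for h
    using linear_cmul[OF has_derivative_linear[OF assms], of h "(1, 0)"] by (simp add: mult.commute)
  then have "(\<lambda>h. F' (h, 0)) = (*) (F' (1, 0))" by blast
  ultimately show ?thesis unfolding has_field_derivative_def deriv_fst_def F' by metis
qed

lemma smooth_on_has_deriv_fst:
  "smooth_on U F \<Longrightarrow> (s, y) \<in> U \<Longrightarrow> ((\<lambda>s. F (s, y)) has_real_derivative deriv_fst F (s, y)) (at s)"
  by (rule has_derivative_deriv_fst[OF smooth_on_has_derivative])

text \<open>Locally \<open>F\<close> vanishes on the open set \<open>T \<times> (- K)\<close>, hence
  so does its derivative, with the same \<open>T\<close> and \<open>K\<close>.\<close>

lemma loc_supp_deriv_fst:
  fixes F :: "real \<times> 'a::euclidean_space \<Rightarrow> real"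
  assumes "loc_supp S F" shows "loc_supp S (deriv_fst F)"
  unfolding loc_supp_def
proof
  fix s assume "s \<in> S"
  then obtain T K where TK: "open T" "s \<in> T" "compact K"
    "\<And>s' y. s' \<in> T \<Longrightarrow> y \<notin> K \<Longrightarrow> F (s', y) = 0"
    using loc_suppE[OF assms] by metis
  have "deriv_fst F (s', y) = 0" if "s' \<in> T" "y \<notin> K" for s' y
  proof -
    have "((\<lambda>q. 0) has_derivative (\<lambda>h. 0)) (at (s', y))" by simp
    then have "(F has_derivative (\<lambda>h. 0)) (at (s', y))"
      by (rule has_derivative_transform_within_open[of _ _ _ _ "T \<times> (- K)"])
        (use TK that in \<open>auto simp: open_Times compact_imp_closed open_Compl\<close>)
    from frechet_derivative_at[OF this] show ?thesis by (simp add: deriv_fst_def fun_eq_iff)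
  qed
  then show "\<exists>T K. open T \<and> s \<in> T \<and> compact K \<and> (\<forall>s'\<in>T. \<forall>y. y \<notin> K \<longrightarrow> deriv_fst F (s', y) = 0)"
    using TK by blast
qed

lemma loc_supp_local_box:
  fixes F :: "'s::euclidean_space \<times> 'a::euclidean_space \<Rightarrow> real"
  assumes "open S" "loc_supp S F" "s \<in> S"
  obtains r a b where "r > 0" "ball s r \<subseteq> S"
    "\<And>s' y. s' \<in> ball s r \<Longrightarrow> y \<notin> cbox a b \<Longrightarrow> F (s', y) = 0"
proof -
  obtain T K where TK: "open T" "s \<in> T" "compact K"
    "\<And>s' y. s' \<in> T \<Longrightarrow> y \<notin> K \<Longrightarrow> F (s', y) = 0"
    using loc_suppE[OF assms(2,3)] by metis
  have "open (T \<inter> S)" "s \<in> T \<inter> S" using TK assms by auto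
  then obtain r where r: "r > 0" "ball s r \<subseteq> T \<inter> S" using open_contains_ball by blast
  obtain a b where "K \<subseteq> cbox a b"
    using bounded_subset_cbox_symmetric[OF compact_imp_bounded[OF TK(3)]] by metis
  then show thesis using that[of r a b] r TK(4) by blast
qed

lemma continuous_on_section:
  assumes "continuous_on (S \<times> UNIV) F" "s \<in> S" shows "continuous_on UNIV (\<lambda>y. F (s, y))"
  by (rule continuous_on_compose2[OF assms(1)]) (use assms(2) in \<open>auto intro!: continuous_intros\<close>)

lemma param_integrable:
  fixes F :: "'s::euclidean_space \<times> 'a::euclidean_space \<Rightarrow> real"
  assumes "open S" "continuous_on (S \<times> UNIV) F" "loc_supp S F" "s \<in> S"
  shows "integrable lborel (\<lambda>y. F (s, y))"
proof -
  obtain r a b where *: "r > 0" "\<And>s' y. s' \<in> ball s r \<Longrightarrow> y \<notin> cbox a b \<Longrightarrow> F (s', y) = 0"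
    using loc_supp_local_box[OF assms(1,3,4)] by metis
  then have "\<And>y. y \<notin> cbox a b \<Longrightarrow> F (s, y) = 0" by simp
  then show ?thesis by (rule compact_support_integral(1)[OF continuous_on_section[OF assms(2,4)]])
qed

lemma param_integral_continuous:
  fixes F :: "'s::euclidean_space \<times> 'a::euclidean_space \<Rightarrow> real"
  assumes S: "open S" and F: "continuous_on (S \<times> UNIV) F" and supp: "loc_supp S F"
  shows "continuous_on S (\<lambda>s. LINT y|lborel. F (s, y))"
proof (rule continuous_at_imp_continuous_on, rule ballI)
  fix s assume s: "s \<in> S"
  obtain r a b where *: "r > 0" "ball s r \<subseteq> S"
    "\<And>s' y. s' \<in> ball s r \<Longrightarrow> y \<notin> cbox a b \<Longrightarrow> F (s', y) = 0"
    using loc_supp_local_box[OF S supp s] by metis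
  have "continuous_on (ball s r) (\<lambda>s. integral (cbox a b) (\<lambda>y. F (s, y)))"
    by (rule integral_continuous_on_param)
      (use continuous_on_subset[OF F, of "ball s r \<times> cbox a b"] *(2) in auto)
  moreover have "(LINT y|lborel. F (s', y)) = integral (cbox a b) (\<lambda>y. F (s', y))" if "s' \<in> ball s r" for s'
    by (rule compact_support_integral(2)[OF continuous_on_section[OF F]]) (use * that in auto)
  ultimately have "continuous_on (ball s r) (\<lambda>s. LINT y|lborel. F (s, y))"
    using continuous_on_cong by (metis (no_types, lifting))
  then show "isCont (\<lambda>s. LINT y|lborel. F (s, y)) s"
    using *(1) by (simp add: continuous_on_eq_continuous_at)
qed

lemma param_integral_deriv:
  fixes F :: "real \<times> 'a::euclidean_space \<Rightarrow> real"
  assumes S: "open S" and F: "smooth_on (S \<times> UNIV) F" and supp: "loc_supp S F" and s: "s \<in> S"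
  shows "((\<lambda>s. LINT y|lborel. F (s, y)) has_real_derivative (LINT y|lborel. deriv_fst F (s, y))) (at s)"
proof -
  note cF = smooth_on_imp_continuous_on[OF F]
  note cD = smooth_on_imp_continuous_on[OF smooth_on_deriv_fst[OF F]]
  obtain r a b where *: "r > 0" "ball s r \<subseteq> S"
    "\<And>s' y. s' \<in> ball s r \<Longrightarrow> y \<notin> cbox a b \<Longrightarrow> F (s', y) = 0"
    using loc_supp_local_box[OF S supp s] by metis
  obtain r' a' b' where **: "r' > 0" "ball s r' \<subseteq> S"
    "\<And>s' y. s' \<in> ball s r' \<Longrightarrow> y \<notin> cbox a' b' \<Longrightarrow> deriv_fst F (s', y) = 0"
    using loc_supp_local_box[OF S loc_supp_deriv_fst[OF supp] s] by metis
  obtain A where A: "cbox a b \<union> cbox a' b' \<subseteq> cbox (- A) A"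
    using bounded_subset_cbox_symmetric[OF bounded_Un[THEN iffD2, OF conjI[OF bounded_cbox bounded_cbox]]] by metis
  define U where "U = ball s (min r r')"
  have U: "U \<subseteq> S" "s \<in> U" "convex U" "open U" using * ** by (auto simp: U_def)
  have z: "F (s', y) = 0" "deriv_fst F (s', y) = 0" if "s' \<in> U" "y \<notin> cbox (- A) A" for s' y
    using that *(3)[of s' y] **(3)[of s' y] A by (auto simp: U_def)
  have "((\<lambda>s. integral (cbox (- A) A) (\<lambda>y. F (s, y))) has_field_derivative
      integral (cbox (- A) A) (\<lambda>y. deriv_fst F (s, y))) (at s within U)"
  proof (rule leibniz_rule_field_derivative[of U "- A" A "\<lambda>s y. F (s, y)" "\<lambda>s y. deriv_fst F (s, y)"])
    show "((\<lambda>x. F (x, t)) has_real_derivative deriv_fst F (x, t)) (at x within U)" if "x \<in> U" for x t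
      using U that by (intro has_field_derivative_at_within[OF smooth_on_has_deriv_fst[OF F]]) auto
    show "(\<lambda>y. F (x, y)) integrable_on cbox (- A) A" if "x \<in> U" for x
      using continuous_on_section[OF cF, of x] U that
      by (intro integrable_continuous) (auto intro: continuous_on_subset)
    show "continuous_on (U \<times> cbox (- A) A) (\<lambda>(x, t). deriv_fst F (x, t))"
      using continuous_on_subset[OF cD, of "U \<times> cbox (- A) A"] U by auto
  qed (use U in auto)
  then have "((\<lambda>s. integral (cbox (- A) A) (\<lambda>y. F (s, y))) has_field_derivative
      integral (cbox (- A) A) (\<lambda>y. deriv_fst F (s, y))) (at s)"
    unfolding at_within_open[OF U(2,4)] .
  moreover have "(LINT y|lborel. deriv_fst F (s, y)) = integral (cbox (- A) A) (\<lambda>y. deriv_fst F (s, y))"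
    by (rule compact_support_integral(2)[OF continuous_on_section[OF cD]]) (use U z in auto)
  moreover have "(LINT y|lborel. F (s', y)) = integral (cbox (- A) A) (\<lambda>y. F (s', y))" if "s' \<in> U" for s'
    by (rule compact_support_integral(2)[OF continuous_on_section[OF cF]]) (use U z that in auto)
  ultimately show ?thesis
    using has_field_derivative_transform_within_open[of "\<lambda>s. integral (cbox (- A) A) (\<lambda>y. F (s, y))" _ s U] U
    by simp
qed

text \<open>In exponential coordinates the group inverse is \<open>uminus\<close>, so this is the
  invariance of Haar measure under inversion.\<close>

lemma lborel_distr_minus: "distr lborel borel (uminus :: 'a::euclidean_space \<Rightarrow> 'a) = lborel"
  using lborel_affine[of "- 1" "0 :: 'a"] by (simp add: density_1 one_ennreal_def[symmetric])

section \<open>The heat semigroup near time zero\<close>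

locale carnot_heat = carnot_group gm ginv \<sigma>
  for gm :: "real^'n \<Rightarrow> real^'n \<Rightarrow> real^'n" and ginv :: "real^'n \<Rightarrow> real^'n" and \<sigma> :: "'n \<Rightarrow> nat" +
  fixes B :: "(real^'n) set" and p :: "real^'n \<Rightarrow> real \<Rightarrow> real"
  assumes basis: "horizontal_basis \<sigma> B" and heat: "heat_kernel gm B p"
begin

lemma p_nonneg: "0 \<le> p x t" and p_zero: "t \<le> 0 \<Longrightarrow> p x t = 0"
  and p_smooth: "smooth_on (- {(0, 0)}) (\<lambda>(x, t). p x t)"
  and p_lim: "((\<lambda>(x, t). p x t) \<longlongrightarrow> 0) at_infinity"
  and p_heat: "t > 0 \<Longrightarrow> ((\<lambda>t. p x t) has_real_derivative sublap gm B (\<lambda>x. p x t) x) (at t)"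
  and p_dirac: "test_fun \<phi> \<Longrightarrow> ((\<lambda>t. LINT x|lborel. p x t * \<phi> x) \<longlongrightarrow> \<phi> 0) (at_right 0)"
  using heat unfolding heat_kernel_def by blast+

lemma ginv_eq: "ginv x = - x"
proof -
  have "gm x (- x) = 0" using one_parameter[of 1 x "- 1"] by simp
  then show ?thesis using inverse_unique by blast
qed

lemma gm_cancel [simp]:
  "gm (gm x (ginv y)) y = x" "gm (gm x y) (ginv y) = x" "gm (ginv x) (gm x y) = y" "gm x (gm (ginv x) y) = y"
  by (simp_all add: assoc) (simp_all add: assoc[symmetric])

lemma ginv_gm: "ginv (gm x y) = gm (ginv y) (ginv x)"
  by (rule inverse_distrib_swap)

lemma continuous_on_gm [continuous_intros]:
  "continuous_on S f \<Longrightarrow> continuous_on S g \<Longrightarrow> continuous_on S (\<lambda>x. gm (f x) (g x))"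
  using continuous_on_compose2[OF smooth_on_imp_continuous_on[OF smooth_mult], of S "\<lambda>x. (f x, g x)"]
  by (auto intro!: continuous_intros)

lemma continuous_on_ginv [continuous_intros]:
  "continuous_on S f \<Longrightarrow> continuous_on S (\<lambda>x. ginv (f x))"
  unfolding ginv_eq by (rule continuous_on_minus)

lemma smooth_on_gm:
  fixes f g :: "'a::real_normed_vector \<Rightarrow> real^'n"
  assumes "open S" "smooth_on S f" "smooth_on S g" shows "smooth_on S (\<lambda>x. gm (f x) (g x))"
  using smooth_on_compose[OF assms(1) open_UNIV smooth_mult smooth_on_Pair[OF assms]] by simp

lemma smooth_on_ginv:
  fixes f :: "'a::real_normed_vector \<Rightarrow> real^'n"
  assumes "open S" "smooth_on S f" shows "smooth_on S (\<lambda>x. ginv (f x))"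
  using smooth_on_compose[OF assms(1) open_UNIV smooth_inv assms(2)] by simp

lemma smooth_on_p:
  fixes f :: "'a::real_normed_vector \<Rightarrow> real^'n"
  assumes "open S" "smooth_on S f" "smooth_on S g" "\<And>x. x \<in> S \<Longrightarrow> g x \<noteq> 0"
  shows "smooth_on S (\<lambda>x. p (f x) (g x))"
proof -
  have "(\<lambda>x. (f x, g x)) ` S \<subseteq> - {(0, 0)}" using assms(4) by force
  from smooth_on_compose[OF assms(1) _ p_smooth smooth_on_Pair[OF assms(1-3)] this]
  show ?thesis by (simp add: open_Compl)
qed

lemma continuous_on_p:
  assumes "continuous_on S f" "continuous_on S g" "\<And>x. x \<in> S \<Longrightarrow> g x \<noteq> 0"
  shows "continuous_on S (\<lambda>x. p (f x) (g x))"
proof -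
  have "(\<lambda>x. (f x, g x)) ` S \<subseteq> - {(0, 0)}" using assms(3) by force
  from continuous_on_compose2[OF smooth_on_imp_continuous_on[OF p_smooth] continuous_on_Pair[OF assms(1,2)] this]
  show ?thesis by simp
qed

text \<open>The map from \<open>z\<close> to \<open>gm x (ginv z)\<close> is inversion followed by a
  left translation, and both preserve Lebesgue measure. It carries the convolution form of the
  semigroup to the form with weight \<open>p z t\<close>.\<close>

lemma lint_right_inv:
  fixes f :: "real^'n \<Rightarrow> real"
  assumes "continuous_on UNIV f"
  shows "(LINT z|lborel. f (gm x (ginv z))) = (LINT y|lborel. f y)"
proof -
  have f: "f \<in> borel_measurable borel" by (rule borel_measurable_continuous_onI[OF assms])
  have g: "gm x \<in> borel_measurable borel"
    by (intro borel_measurable_continuous_onI continuous_intros)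
  have "(LINT z|lborel. f (gm x (ginv z))) = (LINT z|distr lborel borel uminus. f (gm x z))"
    using f g by (subst integral_distr) (auto simp: ginv_eq)
  also have "\<dots> = (LINT z|lborel. f (gm x z))" by (simp add: lborel_distr_minus)
  also have "\<dots> = (LINT y|distr lborel borel (gm x). f y)"
    using f g by (subst integral_distr) auto
  also have "\<dots> = (LINT y|lborel. f y)" by (simp add: lborel_left_invariant)
  finally show ?thesis .
qed

text \<open>The definition of the heat kernel says nothing about total mass. Testing against a bump
  \<open>\<phi>\<close> that is at least 1 on \<open>K\<close> bounds the mass on \<open>K\<close>:
  the Dirac limit puts the integral of \<open>p z t * \<phi> z\<close> below
  \<open>\<phi> 0 + 1\<close> for small \<open>t\<close>, and this is \<open>M\<close>.\<close>

lemma kernel_mass_bound: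
  assumes "compact K"
  obtains M \<delta> where "M \<ge> 0" "\<delta> > 0"
    "\<And>t f c. 0 < t \<Longrightarrow> t < \<delta> \<Longrightarrow> continuous_on UNIV f \<Longrightarrow> (\<And>z. z \<notin> K \<Longrightarrow> f z = 0) \<Longrightarrow>
      (\<And>z. \<bar>f z\<bar> \<le> c) \<Longrightarrow> \<bar>LINT z|lborel. p z t * f z\<bar> \<le> M * c"
proof -
  obtain \<phi> where \<phi>: "test_fun \<phi>" "\<And>x. 0 \<le> \<phi> x" "\<And>x. x \<in> K \<Longrightarrow> 1 \<le> \<phi> x"
    using bump_fun_exists[OF assms] by metis
  obtain K' where K': "compact K'" "\<And>x. x \<notin> K' \<Longrightarrow> \<phi> x = 0" using test_fun_support[OF \<phi>(1)] by metis
  have c\<phi>: "continuous_on UNIV \<phi>"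
    using \<phi>(1) smooth_on_imp_continuous_on unfolding test_fun_def by blast
  have int: "integrable lborel (\<lambda>z. p z t * f z)"
    if "t > 0" "continuous_on UNIV f" "compact C" "\<And>z. z \<notin> C \<Longrightarrow> f z = 0" for t f C
  proof -
    obtain a where a: "C \<subseteq> cbox (- a) a"
      using bounded_subset_cbox_symmetric[OF compact_imp_bounded[OF \<open>compact C\<close>]] by metis
    show ?thesis
      by (rule compact_support_integral(1)[of _ "- a" a])
        (use that a in \<open>auto intro!: continuous_intros continuous_on_p\<close>)
  qed
  have "eventually (\<lambda>t. (LINT z|lborel. p z t * \<phi> z) < \<phi> 0 + 1) (at_right 0)"
    using p_dirac[OF \<phi>(1)] by (rule order_tendstoD) simp
  then obtain \<delta> where \<delta>: "\<delta> > 0" "\<And>t. 0 < t \<Longrightarrow> t < \<delta> \<Longrightarrow> (LINT z|lborel. p z t * \<phi> z) < \<phi> 0 + 1"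
    unfolding eventually_at_right[OF zero_less_one] by metis
  show thesis
  proof (rule that[of "\<phi> 0 + 1" \<delta>])
    show "0 \<le> \<phi> 0 + 1" using \<phi>(2)[of 0] by simp
    fix t c :: real and f assume *: "0 < t" "t < \<delta>" "continuous_on UNIV f" "\<And>z. z \<notin> K \<Longrightarrow> f z = 0"
      "\<And>z. \<bar>f z\<bar> \<le> c"
    have c: "c \<ge> 0" using *(5)[of 0] by linarith
    have "\<bar>LINT z|lborel. p z t * f z\<bar> \<le> (LINT z|lborel. \<bar>p z t * f z\<bar>)"
      by (rule integral_abs_bound)
    also have "\<dots> \<le> (LINT z|lborel. c * (p z t * \<phi> z))"
    proof (rule integral_mono)
      show "integrable lborel (\<lambda>z. \<bar>p z t * f z\<bar>)" using int[OF *(1,3) assms *(4)] by simp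
      show "integrable lborel (\<lambda>z. c * (p z t * \<phi> z))" using int[OF *(1) c\<phi> K'] by simp
      fix z
      have "\<bar>f z\<bar> \<le> c * \<phi> z"
      proof (cases "z \<in> K")
        case True
        then show ?thesis using *(5)[of z] mult_left_mono[OF \<phi>(3)[OF True] c] by simp
      next
        case False
        then show ?thesis using *(4)[of z] \<phi>(2)[of z] c by simp
      qed
      from mult_left_mono[OF this p_nonneg[of z t]] show "\<bar>p z t * f z\<bar> \<le> c * (p z t * \<phi> z)"
        by (simp add: abs_mult p_nonneg algebra_simps)
    qed
    also have "\<dots> = c * (LINT z|lborel. p z t * \<phi> z)" by simp
    also have "\<dots> \<le> c * (\<phi> 0 + 1)" using \<delta>(2)[OF *(1,2)] c by (intro mult_left_mono) auto
    finally show "\<bar>LINT z|lborel. p z t * f z\<bar> \<le> (\<phi> 0 + 1) * c" by (simp add: mult.commute)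
  qed (rule \<delta>(1))
qed

text \<open>The value for \<open>t \<le> 0\<close> is the limit as \<open>t\<close> tends to 0, since \<open>p\<close> has the Dirac mass as initial
  datum.\<close>

definition heat_mean :: "('s \<times> (real^'n) \<Rightarrow> real) \<Rightarrow> 's \<Rightarrow> real \<Rightarrow> real" where
  "heat_mean \<Phi> \<xi> t = (if t \<le> 0 then \<Phi> (\<xi>, 0) else LINT z|lborel. p z t * \<Phi> (\<xi>, z))"

lemma heat_mean_integrand_cont:
  fixes \<Phi> :: "'s::euclidean_space \<times> (real^'n) \<Rightarrow> real"
  assumes "continuous_on UNIV \<Phi>"
  shows "continuous_on ((UNIV \<times> {0<..}) \<times> UNIV) (\<lambda>q. p (snd q) (snd (fst q)) * \<Phi> (fst (fst q), snd q))"
  by (intro continuous_intros continuous_on_p continuous_on_compose2[OF assms]) auto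

lemma heat_mean_integrand_supp:
  fixes \<Phi> :: "'s::euclidean_space \<times> (real^'n) \<Rightarrow> real"
  assumes "loc_supp UNIV \<Phi>"
  shows "loc_supp (UNIV \<times> {0<..}) (\<lambda>q. p (snd q) (snd (fst q)) * \<Phi> (fst (fst q), snd q))"
proof (rule loc_supp_mult, unfold loc_supp_def, rule ballI)
  fix s :: "'s \<times> real"
  obtain T K where TK: "open T" "fst s \<in> T" "compact K"
    "\<And>s' y. s' \<in> T \<Longrightarrow> y \<notin> K \<Longrightarrow> \<Phi> (s', y) = 0"
    using loc_suppE[OF assms, of "fst s"] by (metis UNIV_I)
  then show "\<exists>T K. open T \<and> s \<in> T \<and> compact K \<and> (\<forall>s'\<in>T. \<forall>y. y \<notin> K \<longrightarrow> \<Phi> (fst (fst (s', y)), snd (s', y)) = 0)"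
    by (intro exI[of _ "T \<times> UNIV"] exI[of _ K]) (auto simp: open_Times mem_Times_iff)
qed

lemma heat_mean_integrable:
  fixes \<Phi> :: "'s::euclidean_space \<times> (real^'n) \<Rightarrow> real"
  assumes "continuous_on UNIV \<Phi>" "loc_supp UNIV \<Phi>" "t > 0"
  shows "integrable lborel (\<lambda>z. p z t * \<Phi> (\<xi>, z))"
  using param_integrable[OF _ heat_mean_integrand_cont[OF assms(1)] heat_mean_integrand_supp[OF assms(2)], of "(\<xi>, t)"] assms(3)
  by (simp add: open_Times)

text \<open>The critical points are those with \<open>t = 0\<close>. There
  \<open>\<Phi> (x, z)\<close> is split into \<open>\<Phi> (x0, z)\<close>, a fixed test function to
  which the Dirac limit applies, and a difference that is uniformly small for \<open>x\<close> near
  \<open>x0\<close>, whose integral is controlled by \<open>kernel_mass_bound\<close>.\<close>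

lemma heat_mean_continuous:
  fixes \<Phi> :: "'s::euclidean_space \<times> (real^'n) \<Rightarrow> real"
  assumes sm: "smooth_on UNIV \<Phi>" and supp: "loc_supp UNIV \<Phi>"
  shows "continuous_on (UNIV \<times> {0..}) (\<lambda>(\<xi>, t). heat_mean \<Phi> \<xi> t)"
proof (rule continuous_on_eq_continuous_within[THEN iffD2], rule ballI)
  note c\<Phi> = smooth_on_imp_continuous_on[OF sm]
  fix q :: "'s \<times> real" assume q: "q \<in> UNIV \<times> {0..}"
  obtain x0 t0 where q': "q = (x0, t0)" "t0 \<ge> 0" using q by auto
  show "continuous (at q within UNIV \<times> {0..}) (\<lambda>(\<xi>, t). heat_mean \<Phi> \<xi> t)"
  proof (cases "t0 = 0")
    case False
    have op: "open ((UNIV :: 's set) \<times> {0::real<..})" by (simp add: open_Times)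
    have "continuous_on (UNIV \<times> {0<..}) (\<lambda>s. LINT y|lborel. p y (snd s) * \<Phi> (fst s, y))"
      using param_integral_continuous[OF op heat_mean_integrand_cont[OF c\<Phi>] heat_mean_integrand_supp[OF supp]] by simp
    then have "continuous_on (UNIV \<times> {0<..}) (\<lambda>(\<xi>, t). heat_mean \<Phi> \<xi> t)"
      by (rule continuous_on_eq) (auto simp: heat_mean_def)
    then show ?thesis
      using q' False op by (auto simp: continuous_on_eq_continuous_at intro: continuous_at_imp_continuous_within)
  next
    case True
    have "\<exists>d>0. \<forall>q'\<in>UNIV \<times> {0..}. dist q' q < d \<longrightarrow> dist (case q' of (\<xi>, t) \<Rightarrow> heat_mean \<Phi> \<xi> t) (\<Phi> (x0, 0)) < e"
      if "e > 0" for e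
    proof -
      obtain T K where TK: "open T" "x0 \<in> T" "compact K"
        "\<And>s' y. s' \<in> T \<Longrightarrow> y \<notin> K \<Longrightarrow> \<Phi> (s', y) = 0"
        using loc_suppE[OF supp, of x0] by (metis UNIV_I)
      obtain r where r: "r > 0" "cball x0 r \<subseteq> T" using TK open_contains_cball by metis
      obtain M \<delta>1 where M: "M \<ge> 0" "\<delta>1 > 0"
        "\<And>t f c. 0 < t \<Longrightarrow> t < \<delta>1 \<Longrightarrow> continuous_on UNIV f \<Longrightarrow> (\<And>z. z \<notin> K \<Longrightarrow> f z = 0) \<Longrightarrow>
          (\<And>z. \<bar>f z\<bar> \<le> c) \<Longrightarrow> \<bar>LINT z|lborel. p z t * f z\<bar> \<le> M * c"
        using kernel_mass_bound[OF TK(3)] by blast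
      \<comment> \<open>Chosen so that the difference contributes at most
        \<open>M * \<eta> < e / 2\<close>, leaving the other half for the Dirac limit at
        \<open>x0\<close>; \<open>M + 1\<close> keeps the denominator positive.\<close>
      define \<eta> where "\<eta> = e / (2 * (M + 1))"
      have \<eta>: "\<eta> > 0" "M * \<eta> < e / 2" using M(1) that by (auto simp: \<eta>_def field_simps)
      have "uniformly_continuous_on (cball x0 r \<times> K) \<Phi>"
        using TK(3) c\<Phi> by (intro compact_uniformly_continuous) (auto intro: compact_Times continuous_on_subset)
      then obtain d1 where d1: "d1 > 0"
        "\<And>a b. a \<in> cball x0 r \<times> K \<Longrightarrow> b \<in> cball x0 r \<times> K \<Longrightarrow> dist b a < d1 \<Longrightarrow> dist (\<Phi> b) (\<Phi> a) < \<eta>"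
        unfolding uniformly_continuous_on_def using \<eta>(1) by metis
      have sec: "smooth_on UNIV (\<lambda>z. \<Phi> (\<xi>, z))" for \<xi>
        by (rule smooth_on_compose[OF open_UNIV open_UNIV sm smooth_on_Pair[OF open_UNIV
              smooth_on_const[OF open_UNIV] smooth_on_linear[OF bounded_linear_ident open_UNIV]]]) auto
      have "test_fun (\<lambda>z. \<Phi> (x0, z))"
        by (rule test_funI[OF sec TK(3)]) (use TK in auto)
      from tendstoD[OF p_dirac[OF this], of "e / 2"] that
      obtain \<delta>2 where \<delta>2: "\<delta>2 > 0"
        "\<And>t. 0 < t \<Longrightarrow> t < \<delta>2 \<Longrightarrow> dist (LINT z|lborel. p z t * \<Phi> (x0, z)) (\<Phi> (x0, 0)) < e / 2"
        unfolding eventually_at_right[OF zero_less_one] by auto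
      have "isCont \<Phi> (x0, 0)" using c\<Phi> by (simp add: continuous_on_eq_continuous_at)
      then obtain d3 where d3: "d3 > 0" "\<And>b. dist b (x0, 0) < d3 \<Longrightarrow> dist (\<Phi> b) (\<Phi> (x0, 0)) < e"
        unfolding continuous_at_eps_delta using \<open>e > 0\<close> by metis
      define d where "d = min (min r d1) (min (min \<delta>1 \<delta>2) d3)"
      have d: "d > 0" "d \<le> r" "d \<le> d1" "d \<le> \<delta>1" "d \<le> \<delta>2" "d \<le> d3"
        using r d1 M \<delta>2 d3 by (auto simp: d_def)
      have "dist (heat_mean \<Phi> x t) (\<Phi> (x0, 0)) < e" if "t \<ge> 0" "dist (x, t) q < d" for x t
      proof -
        have dx: "dist x x0 < d" using dist_fst_le[of "(x, t)" q] that q' by simp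
        have dt: "t < d" using dist_snd_le[of "(x, t)" q] that q' True by (simp add: dist_real_def)
        show ?thesis
        proof (cases "t = 0")
          case True
          then show ?thesis using d3(2)[of "(x, 0)"] dx d by (simp add: heat_mean_def dist_Pair_Pair)
        next
          case False
          then have t: "t > 0" using that by simp
          have cf: "continuous_on UNIV (\<lambda>z. \<Phi> (x, z) - \<Phi> (x0, z))"
            by (intro continuous_intros smooth_on_imp_continuous_on sec)
          have z0: "\<Phi> (x, z) - \<Phi> (x0, z) = 0" if "z \<notin> K" for z
            using TK r d dx that by (auto simp: subset_iff dist_commute)
          have bd: "\<bar>\<Phi> (x, z) - \<Phi> (x0, z)\<bar> \<le> \<eta>" for z
          proof (cases "z \<in> K")
            case True
            then have "dist (\<Phi> (x, z)) (\<Phi> (x0, z)) < \<eta>"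
              using d dx r by (intro d1(2)) (auto simp: dist_Pair_Pair dist_commute)
            then show ?thesis by (simp add: dist_real_def)
          next
            case False
            then show ?thesis using z0[OF False] \<eta> by simp
          qed
          have "(LINT z|lborel. p z t * \<Phi> (x, z)) - (LINT z|lborel. p z t * \<Phi> (x0, z))
              = (LINT z|lborel. p z t * (\<Phi> (x, z) - \<Phi> (x0, z)))"
            using heat_mean_integrable[OF c\<Phi> supp t] by (simp add: right_diff_distrib)
          moreover have "\<bar>LINT z|lborel. p z t * (\<Phi> (x, z) - \<Phi> (x0, z))\<bar> \<le> M * \<eta>"
            by (rule M(3)[OF t _ cf z0 bd]) (use dt d in auto)
          moreover have "dist (LINT z|lborel. p z t * \<Phi> (x0, z)) (\<Phi> (x0, 0)) < e / 2"
            using \<delta>2(2)[OF t] dt d by auto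
          ultimately have "dist (LINT z|lborel. p z t * \<Phi> (x, z)) (\<Phi> (x0, 0)) < e"
            using \<eta>(2) unfolding dist_real_def by linarith
          then show ?thesis using t by (simp add: heat_mean_def)
        qed
      qed
      then show ?thesis using d(1) by (intro exI[of _ d]) auto
    qed
    moreover have "(case q of (\<xi>, t) \<Rightarrow> heat_mean \<Phi> \<xi> t) = \<Phi> (x0, 0)" using q' True by (simp add: heat_mean_def)
    ultimately show ?thesis unfolding continuous_within_eps_delta by presburger
  qed
qed

lemma heat_mean_deriv:
  fixes \<Phi> :: "real \<times> (real^'n) \<Rightarrow> real"
  assumes sm: "smooth_on UNIV \<Phi>" and supp: "loc_supp UNIV \<Phi>"
  shows "((\<lambda>s. heat_mean \<Phi> s t) has_real_derivative heat_mean (deriv_fst \<Phi>) s t) (at s)"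
proof (cases "t \<le> 0")
  case True
  then show ?thesis using smooth_on_has_deriv_fst[OF sm] by (simp add: heat_mean_def)
next
  case False
  let ?F = "\<lambda>q. p (snd q) t * \<Phi> q"
  have smF: "smooth_on UNIV ?F"
    using False by (intro smooth_on_mult smooth_on_p smooth_on_linear bounded_linear_snd smooth_on_const sm) auto
  have "((\<lambda>s. LINT z|lborel. ?F (s, z)) has_real_derivative (LINT z|lborel. deriv_fst ?F (s, z))) (at s)"
    using smF by (intro param_integral_deriv[OF open_UNIV _ loc_supp_mult[OF supp]]) auto
  moreover have "deriv_fst ?F (s, z) = p z t * deriv_fst \<Phi> (s, z)" for z
    using DERIV_unique[OF smooth_on_has_deriv_fst[OF smF, of s z]] DERIV_cmult[OF smooth_on_has_deriv_fst[OF sm, of s z]] by simp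
  ultimately show ?thesis using False by (simp add: heat_mean_def)
qed

lemma translate_smooth:
  fixes \<kappa> :: "'s::euclidean_space \<Rightarrow> real^'n"
  assumes "test_fun h" "smooth_on UNIV \<kappa>"
  shows "smooth_on UNIV (\<lambda>(\<xi>, z). h (gm (\<kappa> \<xi>) (ginv z)))"
proof -
  have "smooth_on UNIV h" using assms(1) by (simp add: test_fun_def)
  moreover have "smooth_on UNIV (\<lambda>q. gm (\<kappa> (fst q)) (ginv (snd q)))"
    by (intro smooth_on_gm smooth_on_ginv smooth_on_compose[OF open_UNIV open_UNIV assms(2)]
        smooth_on_linear bounded_linear_fst bounded_linear_snd) auto
  ultimately have "smooth_on UNIV (\<lambda>q. h (gm (\<kappa> (fst q)) (ginv (snd q))))"
    by (rule smooth_on_compose[OF open_UNIV open_UNIV _ _ subset_UNIV])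
  then show ?thesis by (simp add: case_prod_beta')
qed

lemma translate_supp:
  fixes \<kappa> :: "'s::euclidean_space \<Rightarrow> real^'n"
  assumes "test_fun h" "continuous_on UNIV \<kappa>"
  shows "loc_supp UNIV (\<lambda>(\<xi>, z). h (gm (\<kappa> \<xi>) (ginv z)))"
  unfolding loc_supp_def
proof
  fix s :: 's
  obtain K where K: "compact K" "\<And>x. x \<notin> K \<Longrightarrow> h x = 0" using test_fun_support[OF assms(1)] by metis
  \<comment> \<open>Solving \<open>gm (\<kappa> \<xi>) (ginv z) = k\<close> for \<open>z\<close>
    gives \<open>gm (ginv k) (\<kappa> \<xi>)\<close>, so \<open>K'\<close> collects every
    \<open>z\<close> that can meet the support while \<open>\<xi>\<close> stays in the ball.\<close>
  define K' where "K' = (\<lambda>q. gm (ginv (snd q)) (fst q)) ` (\<kappa> ` cball s 1 \<times> K)"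
  have "compact K'" unfolding K'_def
    by (intro compact_continuous_image compact_Times continuous_intros K compact_cball)
      (use assms(2) continuous_on_subset in blast)
  moreover have "h (gm (\<kappa> \<xi>) (ginv z)) = 0" if "\<xi> \<in> ball s 1" "z \<notin> K'" for \<xi> z
  proof (rule K(2), rule notI)
    assume "gm (\<kappa> \<xi>) (ginv z) \<in> K"
    then have "(\<kappa> \<xi>, gm (\<kappa> \<xi>) (ginv z)) \<in> \<kappa> ` cball s 1 \<times> K" using that by auto
    from imageI[OF this, of "\<lambda>q. gm (ginv (snd q)) (fst q)"]
    have "z \<in> K'" by (simp add: K'_def ginv_gm)
    then show False using that by simp
  qed
  ultimately show "\<exists>T K. open T \<and> s \<in> T \<and> compact K \<and>
      (\<forall>s'\<in>T. \<forall>y. y \<notin> K \<longrightarrow> (case (s', y) of (\<xi>, z) \<Rightarrow> h (gm (\<kappa> \<xi>) (ginv z))) = 0)"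
    by (intro exI[of _ "ball s 1"] exI[of _ K']) auto
qed

text \<open>The semigroup after the substitution \<open>y = gm x (ginv z)\<close>, extended to time
  0 by the initial datum. The dependence on \<open>x\<close> sits in \<open>h\<close> and not in the
  kernel, which is singular at time 0.\<close>

definition heat_flow :: "(real^'n \<Rightarrow> real) \<Rightarrow> real^'n \<Rightarrow> real \<Rightarrow> real" where
  "heat_flow h x t = heat_mean (\<lambda>(\<xi>, z). h (gm \<xi> (ginv z))) x t"

lemma heat_flow_zero [simp]: "heat_flow h x 0 = h x"
  by (simp add: heat_flow_def heat_mean_def ginv_eq)

lemma heat_flow_eq_heat_mean: "heat_flow h (\<kappa> s) t = heat_mean (\<lambda>(s, z). h (gm (\<kappa> s) (ginv z))) s t"
  by (simp add: heat_flow_def heat_mean_def)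

lemma heat_flow_eq_semigroup:
  assumes "t > 0" "continuous_on UNIV h"
  shows "heat_flow h x t = heat_semigroup gm ginv p t h x"
proof -
  have "continuous_on UNIV (\<lambda>y. p (gm (ginv y) x) t * h y)"
    using assms by (intro continuous_intros continuous_on_p) auto
  from lint_right_inv[OF this, of x] show ?thesis
    using assms by (simp add: heat_flow_def heat_mean_def heat_semigroup_def ginv_gm)
qed

lemma heat_flow_continuous:
  assumes "test_fun h" shows "continuous_on (UNIV \<times> {0..}) (\<lambda>(x, t). heat_flow h x t)"
  unfolding heat_flow_def
  by (intro heat_mean_continuous translate_smooth translate_supp assms continuous_intros
      smooth_on_linear bounded_linear_ident) auto

end

section \<open>The maximum principle\<close>

text \<open>If \<open>c2\<close> were positive, \<open>c1\<close>, which vanishes at the maximum,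
  would be positive just to the right of 0, and by the mean value theorem \<open>c\<close> would
  exceed \<open>c 0\<close> there.\<close>

lemma second_derivative_at_max:
  fixes c c1 :: "real \<Rightarrow> real"
  assumes "\<And>s. (c has_real_derivative c1 s) (at s)" "(c1 has_real_derivative c2) (at 0)"
    and max: "\<And>s. c s \<le> c 0"
  shows "c2 \<le> 0"
proof (rule ccontr)
  assume "\<not> c2 \<le> 0"
  then have "c2 > 0" by simp
  then obtain d where d: "d > 0" "\<And>h. 0 < h \<Longrightarrow> h < d \<Longrightarrow> c1 0 < c1 (0 + h)"
    using DERIV_pos_inc_right[OF assms(2)] by auto
  have "c1 0 = 0"
    by (rule DERIV_local_max[OF assms(1)[of 0] zero_less_one]) (use max in auto)
  obtain z where "0 < z" "z < d / 2" "c (d / 2) - c 0 = (d / 2 - 0) * c1 z"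
    using MVT2[of 0 "d / 2" c c1] assms(1) d(1) by auto
  moreover from this have "c1 z > 0" using d(2)[of z] \<open>c1 0 = 0\<close> by simp
  then have "(d / 2 - 0) * c1 z > 0" using d(1) by (intro mult_pos_pos) auto
  ultimately show False using max[of "d / 2"] by linarith
qed

context carnot_heat
begin

text \<open>Derivatives are demanded by explicit witnesses because \<open>linv_field\<close> rests
  on \<open>deriv\<close>, which has a value even where no derivative exists. \<open>c1\<close> is
  given along the whole curve and \<open>c2\<close> at 0 only, as
  \<open>second_derivative_at_max\<close> requires.\<close>

definition heat_sol :: "(real^'n \<Rightarrow> real \<Rightarrow> real) \<Rightarrow> bool" where
  "heat_sol W \<longleftrightarrow> (\<forall>x. \<forall>t>0. \<exists>c1 c2. (W x has_real_derivative (\<Sum>v\<in>B. c2 v)) (at t) \<and>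
     (\<forall>v\<in>B. (\<forall>s. ((\<lambda>s. W (gm x (s *\<^sub>R v)) t) has_real_derivative c1 v s) (at s)) \<and>
       (c1 v has_real_derivative c2 v) (at 0)))"

lemma heat_solI:
  assumes "\<And>x t. t > 0 \<Longrightarrow> (W x has_real_derivative (\<Sum>v\<in>B. c2 x t v)) (at t)"
    "\<And>x t v s. t > 0 \<Longrightarrow> v \<in> B \<Longrightarrow> ((\<lambda>s. W (gm x (s *\<^sub>R v)) t) has_real_derivative c1 x t v s) (at s)"
    "\<And>x t v. t > 0 \<Longrightarrow> v \<in> B \<Longrightarrow> (c1 x t v has_real_derivative c2 x t v) (at 0)"
  shows "heat_sol W"
  unfolding heat_sol_def
proof (intro allI impI)
  fix x :: "real^'n" and t :: real assume "t > 0"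
  then show "\<exists>c1 c2. (W x has_real_derivative (\<Sum>v\<in>B. c2 v)) (at t) \<and>
     (\<forall>v\<in>B. (\<forall>s. ((\<lambda>s. W (gm x (s *\<^sub>R v)) t) has_real_derivative c1 v s) (at s)) \<and>
       (c1 v has_real_derivative c2 v) (at 0))"
    using assms by (intro exI[of _ "c1 x t"] exI[of _ "c2 x t"]) auto
qed

lemma heat_sol_diff:
  assumes "heat_sol V" "heat_sol W" shows "heat_sol (\<lambda>x t. V x t - W x t)"
  unfolding heat_sol_def
proof (intro allI impI)
  fix x :: "real^'n" and t :: real assume "t > 0"
  obtain c1 c2 where c: "(V x has_real_derivative (\<Sum>v\<in>B. c2 v)) (at t)"
    "\<And>v s. v \<in> B \<Longrightarrow> ((\<lambda>s. V (gm x (s *\<^sub>R v)) t) has_real_derivative c1 v s) (at s)"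
    "\<And>v. v \<in> B \<Longrightarrow> (c1 v has_real_derivative c2 v) (at 0)"
    using assms(1) \<open>t > 0\<close> unfolding heat_sol_def by metis
  obtain d1 d2 where d: "(W x has_real_derivative (\<Sum>v\<in>B. d2 v)) (at t)"
    "\<And>v s. v \<in> B \<Longrightarrow> ((\<lambda>s. W (gm x (s *\<^sub>R v)) t) has_real_derivative d1 v s) (at s)"
    "\<And>v. v \<in> B \<Longrightarrow> (d1 v has_real_derivative d2 v) (at 0)"
    using assms(2) \<open>t > 0\<close> unfolding heat_sol_def by metis
  show "\<exists>c1 c2. ((\<lambda>t. V x t - W x t) has_real_derivative (\<Sum>v\<in>B. c2 v)) (at t) \<and>
     (\<forall>v\<in>B. (\<forall>s. ((\<lambda>s. V (gm x (s *\<^sub>R v)) t - W (gm x (s *\<^sub>R v)) t) has_real_derivative c1 v s) (at s)) \<and>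
       (c1 v has_real_derivative c2 v) (at 0))"
  proof (intro exI[of _ "\<lambda>v s. c1 v s - d1 v s"] exI[of _ "\<lambda>v. c2 v - d2 v"] conjI ballI allI)
    show "((\<lambda>t. V x t - W x t) has_real_derivative (\<Sum>v\<in>B. c2 v - d2 v)) (at t)"
      using DERIV_diff[OF c(1) d(1)] by (simp add: sum_subtractf)
  qed (use c d in \<open>auto intro!: DERIV_diff\<close>)
qed

text \<open>Uniformity is asked for bounded times only, because this property passes to time
  integrals of the flow, whose bound grows with \<open>T\<close>.\<close>

definition vanishing :: "(real^'n \<Rightarrow> real \<Rightarrow> real) \<Rightarrow> bool" where
  "vanishing W \<longleftrightarrow> (\<forall>T. \<forall>e>0. \<exists>R. \<forall>x t. 0 \<le> t \<longrightarrow> t \<le> T \<longrightarrow> R \<le> norm x \<longrightarrow> \<bar>W x t\<bar> < e)"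

lemma vanishing_diff:
  assumes "vanishing V" "vanishing W" shows "vanishing (\<lambda>x t. V x t - W x t)"
  unfolding vanishing_def
proof (intro allI impI)
  fix T e :: real assume "e > 0"
  then have "e / 2 > 0" by simp
  obtain R1 where R1: "\<And>x t. 0 \<le> t \<Longrightarrow> t \<le> T \<Longrightarrow> R1 \<le> norm x \<Longrightarrow> \<bar>V x t\<bar> < e / 2"
    using assms(1) \<open>e / 2 > 0\<close> unfolding vanishing_def by metis
  obtain R2 where R2: "\<And>x t. 0 \<le> t \<Longrightarrow> t \<le> T \<Longrightarrow> R2 \<le> norm x \<Longrightarrow> \<bar>W x t\<bar> < e / 2"
    using assms(2) \<open>e / 2 > 0\<close> unfolding vanishing_def by metis
  have "\<bar>V x t - W x t\<bar> < e" if "0 \<le> t" "t \<le> T" "max R1 R2 \<le> norm x" for x t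
    using R1[of t x] R2[of t x] that by (auto simp: max_def split: if_splits)
  then show "\<exists>R. \<forall>x t. 0 \<le> t \<longrightarrow> t \<le> T \<longrightarrow> R \<le> norm x \<longrightarrow> \<bar>V x t - W x t\<bar> < e" by blast
qed

text \<open>Subtracting \<open>\<delta> * t\<close> makes the inequality at a maximum strict: the
  second derivatives along the horizontal curves are not positive, so the time derivative of
  \<open>V\<close> is at most \<open>- \<delta>\<close>, and \<open>V\<close> would be larger
  slightly earlier.\<close>

lemma max_principle:
  assumes sol: "heat_sol W" and cont: "continuous_on (UNIV \<times> {0..}) (\<lambda>(x, t). W x t)"
    and van: "vanishing W" and init: "\<And>x. W x 0 \<le> 0" and t0: "t0 \<ge> 0"
  shows "W x0 t0 \<le> 0"
proof (rule ccontr)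
  assume "\<not> W x0 t0 \<le> 0"
  define m where "m = W x0 t0"
  have m: "m > 0" using \<open>\<not> W x0 t0 \<le> 0\<close> by (simp add: m_def)
  have "t0 > 0" using init[of x0] m t0 by (cases "t0 = 0") (auto simp: m_def)
  \<comment> \<open>With this slope \<open>V\<close> still equals \<open>m / 2\<close> at
    \<open>(x0, t0)\<close>, above the bound \<open>m / 4\<close> that holds far away.\<close>
  define \<delta> where "\<delta> = m / (2 * t0)"
  have \<delta>: "\<delta> > 0" "\<delta> * t0 = m / 2" using m \<open>t0 > 0\<close> by (auto simp: \<delta>_def)
  define V where "V x t = W x t - \<delta> * t" for x t
  have V0: "V x0 t0 = m / 2" using \<delta> by (simp add: V_def m_def)
  obtain R where R: "\<And>x t. 0 \<le> t \<Longrightarrow> t \<le> t0 \<Longrightarrow> R \<le> norm x \<Longrightarrow> \<bar>W x t\<bar> < m / 4"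
    using van m unfolding vanishing_def by (metis divide_pos_pos zero_less_numeral)
  define K where "K = cball (0 :: real^'n) (max R (norm x0)) \<times> {0..t0}"
  have K: "compact K" "(x0, t0) \<in> K" using t0 by (auto simp: K_def compact_Times)
  have "continuous_on K (\<lambda>q. (\<lambda>(x, t). W x t) q - \<delta> * snd q)"
    by (intro continuous_intros continuous_on_subset[OF cont]) (auto simp: K_def)
  moreover have "K \<noteq> {}" using K(2) by blast
  ultimately have "\<exists>q\<in>K. \<forall>r\<in>K. V (fst r) (snd r) \<le> V (fst q) (snd q)"
    using continuous_attains_sup[OF K(1)] unfolding V_def case_prod_beta' by blast
  then obtain q where
    q: "q \<in> K" "\<And>r. r \<in> K \<Longrightarrow> V (fst r) (snd r) \<le> V (fst q) (snd q)" by blast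
  obtain x1 t1 where q1: "q = (x1, t1)" by (cases q)
  have t1: "0 \<le> t1" "t1 \<le> t0" using q(1) q1 by (auto simp: K_def)
  have V1: "m / 2 \<le> V x1 t1" using q(2)[OF K(2)] V0 q1 by simp
  have glob: "V x t \<le> V x1 t1" if "0 \<le> t" "t \<le> t0" for x t
  proof (cases "(x, t) \<in> K")
    case True
    then show ?thesis using q(2)[of "(x, t)"] q1 by simp
  next
    case False
    then have "R \<le> norm x" using that by (auto simp: K_def)
    then have "W x t < m / 4" using R[of t x] that by simp
    moreover have "V x t \<le> W x t" using \<delta>(1) that by (simp add: V_def)
    ultimately show ?thesis using V1 m by simp
  qed
  have "t1 > 0" using V1 init[of x1] m t1 by (cases "t1 = 0") (auto simp: V_def)
  then obtain c1 c2 where c: "(W x1 has_real_derivative (\<Sum>v\<in>B. c2 v)) (at t1)"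
    "\<And>v s. v \<in> B \<Longrightarrow> ((\<lambda>s. W (gm x1 (s *\<^sub>R v)) t1) has_real_derivative c1 v s) (at s)"
    "\<And>v. v \<in> B \<Longrightarrow> (c1 v has_real_derivative c2 v) (at 0)"
    using sol unfolding heat_sol_def by metis
  have "c2 v \<le> 0" if "v \<in> B" for v
  proof (rule second_derivative_at_max[OF c(2,3)[OF that]])
    fix s :: real
    show "W (gm x1 (s *\<^sub>R v)) t1 \<le> W (gm x1 (0 *\<^sub>R v)) t1"
      using glob[of t1 "gm x1 (s *\<^sub>R v)"] t1 by (simp add: V_def)
  qed
  then have "(\<Sum>v\<in>B. c2 v) - \<delta> < 0" using sum_nonpos[of B c2] \<delta>(1) by auto
  moreover have "(V x1 has_real_derivative (\<Sum>v\<in>B. c2 v) - \<delta>) (at t1)"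
    unfolding V_def[abs_def] using c(1) by (auto intro!: derivative_eq_intros)
  \<comment> \<open>Only a step backwards in time is taken, so a maximum at the final time
    \<open>t1 = t0\<close> is covered as well.\<close>
  ultimately obtain d where d: "d > 0" "\<And>h. 0 < h \<Longrightarrow> h < d \<Longrightarrow> V x1 t1 < V x1 (t1 - h)"
    using DERIV_neg_dec_left by metis
  define h where "h = min (d / 2) (t1 / 2)"
  have "0 < h" "h < d" "h < t1" using d(1) \<open>t1 > 0\<close> by (auto simp: h_def)
  then show False using d(2)[of h] glob[of "t1 - h" x1] t1 by simp
qed

lemma heat_unique:
  assumes "heat_sol W" "continuous_on (UNIV \<times> {0..}) (\<lambda>(x, t). W x t)"
    and "vanishing W" "\<And>x. W x 0 = 0" "t \<ge> 0"
  shows "W x t = 0"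
proof -
  have z: "heat_sol (\<lambda>x t. 0)" by (rule heat_solI[where ?c1.0 = "\<lambda>_ _ _ _. 0" and ?c2.0 = "\<lambda>_ _ _. 0"]) auto
  have z': "vanishing (\<lambda>x t. 0)" unfolding vanishing_def by auto
  have "W x t \<le> 0" using max_principle[OF assms(1-3)] assms(4,5) by simp
  \<comment> \<open>The negative of \<open>W\<close> is written as a difference from the zero
    solution so that \<open>heat_sol_diff\<close> and \<open>vanishing_diff\<close> apply.\<close>
  moreover have "0 - W x t \<le> 0"
  proof (rule max_principle[OF heat_sol_diff[OF z assms(1)] _ vanishing_diff[OF z' assms(3)]])
    show "continuous_on (UNIV \<times> {0..}) (\<lambda>(x, t). 0 - W x t)"
      using continuous_on_minus[OF assms(2)] by (simp add: case_prod_beta')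
  qed (use assms in auto)
  ultimately show ?thesis by simp
qed

section \<open>The heat semigroup solves the heat equation\<close>

lemma finite_B: "finite B"
  using basis independent_imp_finite unfolding horizontal_basis_def by blast

lemma layer1: "v \<in> B \<Longrightarrow> v \<in> layer \<sigma> 1"
  using basis span_base unfolding horizontal_basis_def by blast

lemma gm_scale: "gm (gm x (s *\<^sub>R v)) (t *\<^sub>R v) = gm x ((s + t) *\<^sub>R v)"
  by (simp add: assoc one_parameter)

text \<open>By the one-parameter law, continuing from \<open>gm x (s *\<^sub>R v)\<close> in
  direction \<open>v\<close> stays on the same curve through \<open>x\<close>. Applying the field
  twice is therefore an ordinary second derivative along one curve.\<close>

lemma linv_field_twice:
  assumes "\<And>s. ((\<lambda>s. F (gm x (s *\<^sub>R v))) has_real_derivative c1 s) (at s)"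
    "(c1 has_real_derivative c2) (at 0)"
  shows "linv_field gm v (linv_field gm v F) x = c2"
proof -
  have "linv_field gm v F (gm x (s *\<^sub>R v)) = c1 s" for s
  proof -
    have "((\<lambda>t. F (gm x ((s + t) *\<^sub>R v))) has_real_derivative c1 s) (at 0)"
      using assms(1)[of s] DERIV_shift[of "\<lambda>s. F (gm x (s *\<^sub>R v))" "c1 s" 0 s] by (simp add: add.commute)
    then show ?thesis by (simp add: linv_field_def gm_scale DERIV_imp_deriv)
  qed
  then show ?thesis unfolding linv_field_def[of gm v "linv_field gm v F"]
    using assms(2) by (simp add: DERIV_imp_deriv)
qed

text \<open>Since \<open>ginv z\<close> stands to the right of \<open>s *\<^sub>R v\<close>, the
  derivative of this function in \<open>s\<close> differentiates \<open>h\<close> in a direction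
  that depends on \<open>z\<close>; it is in general not \<open>linv_field gm v h\<close> at the
  translated point.\<close>

definition curve :: "(real^'n \<Rightarrow> real) \<Rightarrow> real^'n \<Rightarrow> real^'n \<Rightarrow> real \<times> (real^'n) \<Rightarrow> real" where
  "curve h x v = (\<lambda>(s, z). h (gm (gm x (s *\<^sub>R v)) (ginv z)))"

lemma smooth_on_line: "smooth_on UNIV (\<lambda>s::real. gm x (s *\<^sub>R v))"
  by (intro smooth_on_gm smooth_on_linear smooth_on_const bounded_linear_scaleR_left) auto

lemma curve_smooth: "test_fun h \<Longrightarrow> smooth_on UNIV (curve h x v)"
  unfolding curve_def by (rule translate_smooth[OF _ smooth_on_line])

lemma curve_supp: "test_fun h \<Longrightarrow> loc_supp UNIV (curve h x v)"
  unfolding curve_def by (rule translate_supp[OF _ smooth_on_imp_continuous_on[OF smooth_on_line]])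

text \<open>Here the space derivatives fall on \<open>h\<close>, so that they stay continuous up to \<open>t = 0\<close>; for the heat
  equation (\<open>heat_flow_heat\<close>) they fall on \<open>p\<close>.\<close>

lemma heat_flow_curve:
  assumes "test_fun h"
  shows "((\<lambda>s. heat_flow h (gm x (s *\<^sub>R v)) t) has_real_derivative heat_mean (deriv_fst (curve h x v)) s t) (at s)"
    "((\<lambda>s. heat_mean (deriv_fst (curve h x v)) s t) has_real_derivative heat_mean (deriv_fst (deriv_fst (curve h x v))) s t) (at s)"
proof -
  show "((\<lambda>s. heat_flow h (gm x (s *\<^sub>R v)) t) has_real_derivative heat_mean (deriv_fst (curve h x v)) s t) (at s)"
    unfolding heat_flow_eq_heat_mean[of h "\<lambda>s. gm x (s *\<^sub>R v)"] curve_def[symmetric]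
    by (rule heat_mean_deriv[OF curve_smooth[OF assms] curve_supp[OF assms]])
  show "((\<lambda>s. heat_mean (deriv_fst (curve h x v)) s t) has_real_derivative heat_mean (deriv_fst (deriv_fst (curve h x v))) s t) (at s)"
    by (rule heat_mean_deriv[OF smooth_on_deriv_fst[OF curve_smooth[OF assms]] loc_supp_deriv_fst[OF curve_supp[OF assms]]])
qed

lemma sublap_heat_flow:
  assumes "test_fun h"
  shows "sublap gm B (\<lambda>x. heat_flow h x t) x = (\<Sum>v\<in>B. heat_mean (deriv_fst (deriv_fst (curve h x v))) 0 t)"
  unfolding sublap_def by (intro sum.cong refl linv_field_twice[OF heat_flow_curve[OF assms]])

lemma test_fun_continuous: "test_fun h \<Longrightarrow> continuous_on UNIV h"
  unfolding test_fun_def using smooth_on_imp_continuous_on by blast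

lemma deriv_fst_mult_snd:
  fixes F :: "real \<times> (real^'n) \<Rightarrow> real"
  assumes "smooth_on UNIV F" "smooth_on UNIV h"
  shows "deriv_fst (\<lambda>q. F q * h (snd q)) = (\<lambda>q. deriv_fst F q * h (snd q))"
proof
  fix q :: "real \<times> (real^'n)"
  obtain s y where q: "q = (s, y)" by (cases q)
  have "smooth_on UNIV (\<lambda>q. F q * h (snd q))"
    by (intro smooth_on_mult assms smooth_on_compose[OF open_UNIV open_UNIV assms(2)]
        smooth_on_linear bounded_linear_snd) auto
  from smooth_on_has_deriv_fst[OF this, of s y]
  have "((\<lambda>s. F (s, y) * h y) has_real_derivative deriv_fst (\<lambda>q. F q * h (snd q)) (s, y)) (at s)" by simp
  moreover have "((\<lambda>s. F (s, y) * h y) has_real_derivative deriv_fst F (s, y) * h y) (at s)"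
    by (rule DERIV_cmult_right[OF smooth_on_has_deriv_fst[OF assms(1)]]) simp
  ultimately show "deriv_fst (\<lambda>q. F q * h (snd q)) q = deriv_fst F q * h (snd q)"
    using DERIV_unique q by (metis snd_conv)
qed

lemma mult_snd_supp:
  assumes "test_fun h" shows "loc_supp S (\<lambda>q. F q * h (snd q))"
proof -
  obtain K where "compact K" "\<And>x. x \<notin> K \<Longrightarrow> h x = 0" using test_fun_support[OF assms] by metis
  then show ?thesis unfolding loc_supp_def by (auto intro!: exI[of _ UNIV] exI[of _ K])
qed

text \<open>In the convolution form \<open>x\<close> enters only through
  \<open>gm (ginv y) x\<close>, and left translation by \<open>ginv y\<close> commutes with the
  fields. So the sub-Laplacean of the flow is the integral of that of \<open>p\<close>, which is the
  time derivative of \<open>p\<close>.\<close>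

lemma heat_flow_heat:
  assumes h: "test_fun h" and t: "t > 0"
  shows "(heat_flow h x has_real_derivative sublap gm B (\<lambda>x. heat_flow h x t) x) (at t)"
proof -
  have smh: "smooth_on UNIV h" using h by (simp add: test_fun_def)
  note ch = test_fun_continuous[OF h]
  let ?F = "\<lambda>q. p (gm (ginv (snd q)) x) (fst q) * h (snd q)"
  have smF: "smooth_on ({0<..} \<times> UNIV) ?F"
    by (intro smooth_on_mult smooth_on_p smooth_on_gm smooth_on_ginv smooth_on_linear smooth_on_const
        bounded_linear_fst bounded_linear_snd smooth_on_compose[OF _ open_UNIV smh])
      (auto simp: open_Times)
  have "((\<lambda>t. LINT y|lborel. ?F (t, y)) has_real_derivative (LINT y|lborel. deriv_fst ?F (t, y))) (at t)"
    using t by (intro param_integral_deriv[OF _ smF mult_snd_supp[OF h]]) auto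
  then have 1: "(heat_flow h x has_real_derivative (LINT y|lborel. deriv_fst ?F (t, y))) (at t)"
    by (rule has_field_derivative_transform_within_open[of _ _ _ "{0<..}"])
      (use t ch in \<open>auto simp: heat_flow_eq_semigroup heat_semigroup_def\<close>)
  define G where "G v q = p (gm (gm (ginv (snd q)) x) (fst q *\<^sub>R v)) t" for v and q :: "real \<times> (real^'n)"
  have smG: "smooth_on UNIV (G v)" for v
    unfolding G_def[abs_def] using t
    by (intro smooth_on_p smooth_on_gm smooth_on_ginv smooth_on_linear smooth_on_const
        bounded_linear_fst bounded_linear_snd bounded_linear_compose[OF bounded_linear_scaleR_left bounded_linear_fst]) auto
  define G0 where "G0 v q = G v q * h (snd q)" for v q
  have smG0: "smooth_on (UNIV \<times> UNIV) (G0 v)" for v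
    unfolding G0_def[abs_def] UNIV_Times_UNIV
    by (intro smooth_on_mult smG smooth_on_compose[OF _ open_UNIV smh] smooth_on_linear bounded_linear_snd) auto
  have suG0: "loc_supp UNIV (G0 v)" for v unfolding G0_def[abs_def] by (rule mult_snd_supp[OF h])
  have D2: "deriv_fst (deriv_fst (G0 v)) q = deriv_fst (deriv_fst (G v)) q * h (snd q)" for v q
    unfolding G0_def[abs_def] deriv_fst_mult_snd[OF smG smh] deriv_fst_mult_snd[OF smooth_on_deriv_fst[OF smG] smh] ..
  have c: "(\<lambda>s. heat_flow h (gm x (s *\<^sub>R v)) t) = (\<lambda>s. LINT y|lborel. G0 v (s, y))" for v
    by (simp add: heat_flow_eq_semigroup[OF t ch] heat_semigroup_def G0_def G_def assoc)
  have lin: "linv_field gm v (linv_field gm v (\<lambda>x. heat_flow h x t)) x = (LINT y|lborel. deriv_fst (deriv_fst (G0 v)) (0, y))" for v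
  proof (rule linv_field_twice)
    show "((\<lambda>s. heat_flow h (gm x (s *\<^sub>R v)) t) has_real_derivative (LINT y|lborel. deriv_fst (G0 v) (s, y))) (at s)" for s
      unfolding c by (rule param_integral_deriv[OF open_UNIV smG0 suG0]) simp
    show "((\<lambda>s. LINT y|lborel. deriv_fst (G0 v) (s, y)) has_real_derivative (LINT y|lborel. deriv_fst (deriv_fst (G0 v)) (0, y))) (at 0)"
      by (rule param_integral_deriv[OF open_UNIV smooth_on_deriv_fst[OF smG0] loc_supp_deriv_fst[OF suG0]]) simp
  qed
  have linp: "linv_field gm v (linv_field gm v (\<lambda>x. p x t)) (gm (ginv y) x) = deriv_fst (deriv_fst (G v)) (0, y)" for v y
  proof (rule linv_field_twice)
    show "((\<lambda>s. p (gm (gm (ginv y) x) (s *\<^sub>R v)) t) has_real_derivative deriv_fst (G v) (s, y)) (at s)" for s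
      using smooth_on_has_deriv_fst[OF smG, of s y v] by (simp add: G_def)
    show "((\<lambda>s. deriv_fst (G v) (s, y)) has_real_derivative deriv_fst (deriv_fst (G v)) (0, y)) (at 0)"
      by (rule smooth_on_has_deriv_fst[OF smooth_on_deriv_fst[OF smG]]) simp
  qed
  have "deriv_fst ?F (t, y) = (\<Sum>v\<in>B. deriv_fst (deriv_fst (G0 v)) (0, y))" for y
  proof -
    have "((\<lambda>t. p (gm (ginv y) x) t * h y) has_real_derivative deriv_fst ?F (t, y)) (at t)"
      using smooth_on_has_deriv_fst[OF smF, of t y] t by simp
    moreover have "((\<lambda>t. p (gm (ginv y) x) t * h y) has_real_derivative
        sublap gm B (\<lambda>x. p x t) (gm (ginv y) x) * h y) (at t)"
      by (rule DERIV_cmult_right[OF p_heat[OF t]])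
    ultimately have "deriv_fst ?F (t, y) = sublap gm B (\<lambda>x. p x t) (gm (ginv y) x) * h y"
      by (rule DERIV_unique)
    then show ?thesis by (simp add: sublap_def linp D2 sum_distrib_right)
  qed
  then have "(LINT y|lborel. deriv_fst ?F (t, y)) = (\<Sum>v\<in>B. LINT y|lborel. deriv_fst (deriv_fst (G0 v)) (0, y))"
    using param_integrable[OF open_UNIV smooth_on_imp_continuous_on[OF smooth_on_deriv_fst[OF smooth_on_deriv_fst[OF smG0]]]
        loc_supp_deriv_fst[OF loc_supp_deriv_fst[OF suG0]]]
    by (simp add: integral_sum)
  also have "\<dots> = sublap gm B (\<lambda>x. heat_flow h x t) x" by (simp add: sublap_def lin)
  finally show ?thesis using 1 by simp
qed

text \<open>The two forms of the flow meet here: the time derivative comes from the kernel side, the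
  space derivatives from the test function side, and both sums are the same value of
  \<open>sublap\<close>.\<close>

lemma heat_flow_heat_sol: "test_fun h \<Longrightarrow> heat_sol (heat_flow h)"
  by (rule heat_solI[OF _ heat_flow_curve]) (use heat_flow_heat sublap_heat_flow in simp)

text \<open>If \<open>x\<close> is far away and \<open>y\<close> lies in the support of
  \<open>h\<close>, then \<open>gm (ginv y) x\<close> is far away too, where \<open>p\<close> is
  small whatever the time. The integral is then at most \<open>\<eta>\<close> times the integral of
  \<open>\<bar>h\<bar>\<close>.\<close>

lemma heat_flow_vanishing:
  assumes h: "test_fun h" shows "vanishing (heat_flow h)"
  unfolding vanishing_def
proof (intro allI impI)
  fix T e :: real assume e: "e > 0"
  obtain K where K: "compact K" "\<And>x. x \<notin> K \<Longrightarrow> h x = 0" using test_fun_support[OF h] by metis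
  note ch = test_fun_continuous[OF h]
  obtain a where a: "K \<subseteq> cbox (- a) a"
    using bounded_subset_cbox_symmetric[OF compact_imp_bounded[OF K(1)]] by metis
  have ih: "integrable lborel (\<lambda>y. \<bar>h y\<bar>)"
    by (rule compact_support_integral(1)[of _ "- a" a]) (use ch K a in \<open>auto intro!: continuous_intros\<close>)
  define I where "I = (LINT y|lborel. \<bar>h y\<bar>)"
  have I: "I \<ge> 0" unfolding I_def by (rule integral_nonneg_AE) simp
  define \<eta> where "\<eta> = e / (I + 1)"
  have \<eta>: "\<eta> > 0" "\<eta> * I < e" using e I by (auto simp: \<eta>_def field_simps)
  have "eventually (\<lambda>q. dist (case q of (x, t) \<Rightarrow> p x t) 0 < \<eta>) at_infinity"
    by (rule tendstoD[OF p_lim \<eta>(1)])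
  then obtain b where b: "\<And>x t. norm (x, t) \<ge> b \<Longrightarrow> p x t < \<eta>"
    unfolding eventually_at_infinity by (auto simp: p_nonneg)
  \<comment> \<open>If \<open>gm (ginv y) x\<close> lay in the ball for some \<open>y\<close> in
    \<open>K\<close>, then \<open>x = gm y (gm (ginv y) x)\<close> would lie in this bounded
    set.\<close>
  define C where "C = (\<lambda>q. gm (fst q) (snd q)) ` (K \<times> cball 0 b)"
  have "compact C" unfolding C_def
    by (intro compact_continuous_image compact_Times continuous_intros K compact_cball)
  then obtain R where R: "\<And>x. x \<in> C \<Longrightarrow> norm x \<le> R" using compact_imp_bounded bounded_iff by metis
  obtain R' where R': "\<And>x. x \<in> K \<Longrightarrow> norm x \<le> R'" using compact_imp_bounded[OF K(1)] bounded_iff by metis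
  have "\<bar>heat_flow h x t\<bar> < e" if "0 \<le> t" "max R R' + 1 \<le> norm x" for x t
  proof (cases "t = 0")
    case True
    have "x \<notin> K" using R'[of x] that by (auto simp: max_def split: if_splits)
    then show ?thesis using K(2) True e by simp
  next
    case False
    then have t: "t > 0" using that by simp
    have le: "\<bar>p (gm (ginv y) x) t * h y\<bar> \<le> \<eta> * \<bar>h y\<bar>" for y
    proof (cases "y \<in> K")
      case True
      have "norm (gm (ginv y) x) > b"
      proof (rule ccontr)
        assume "\<not> norm (gm (ginv y) x) > b"
        then have "(y, gm (ginv y) x) \<in> K \<times> cball 0 b" using True by auto
        from imageI[OF this, of "\<lambda>q. gm (fst q) (snd q)"] have "x \<in> C" by (simp add: C_def)
        then show False using R[of x] that by simp
      qed
      then have "norm (gm (ginv y) x, t) \<ge> b" using norm_fst_le[of "gm (ginv y) x" t] by simp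
      then have "p (gm (ginv y) x) t \<le> \<eta>" using b less_imp_le by blast
      then show ?thesis by (simp add: abs_mult p_nonneg mult_right_mono)
    next
      case False
      then show ?thesis using K(2) by simp
    qed
    have "integrable lborel (\<lambda>y. p (gm (ginv y) x) t * h y)"
      by (rule compact_support_integral(1)[of _ "- a" a])
        (use ch K a t in \<open>auto intro!: continuous_intros continuous_on_p\<close>)
    then have "\<bar>LINT y|lborel. p (gm (ginv y) x) t * h y\<bar> \<le> (LINT y|lborel. \<eta> * \<bar>h y\<bar>)"
      using le ih by (intro order_trans[OF integral_abs_bound] integral_mono) auto
    also have "\<dots> = \<eta> * I" by (simp add: I_def)
    finally show ?thesis using \<eta> t ch by (simp add: heat_flow_eq_semigroup heat_semigroup_def)
  qed
  then show "\<exists>R. \<forall>x t. 0 \<le> t \<longrightarrow> t \<le> T \<longrightarrow> R \<le> norm x \<longrightarrow> \<bar>heat_flow h x t\<bar> < e" by blast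
qed

end

context carnot_heat
begin

section \<open>Duhamel formula\<close>

text \<open>The field is the partial derivative at \<open>s = 0\<close> of a jointly smooth function
  of \<open>s\<close> and \<open>x\<close>, hence smooth in \<open>x\<close>. It vanishes off
  \<open>K\<close>, because a curve starting off a closed set stays off it for short times.\<close>

lemma test_fun_linv_field:
  assumes "test_fun h" shows "test_fun (linv_field gm v h)"
proof -
  have smh: "smooth_on UNIV h" using assms by (simp add: test_fun_def)
  obtain K where K: "compact K" "\<And>x. x \<notin> K \<Longrightarrow> h x = 0" using test_fun_support[OF assms] by metis
  let ?F = "\<lambda>q. h (gm (snd q) (fst q *\<^sub>R v))"
  have smF: "smooth_on UNIV ?F"
    by (rule smooth_on_compose[OF open_UNIV open_UNIV smh _ subset_UNIV])
      (intro smooth_on_gm smooth_on_linear bounded_linear_snd open_UNIV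
        bounded_linear_compose[OF bounded_linear_scaleR_left bounded_linear_fst])
  have eq: "linv_field gm v h x = deriv_fst ?F (0, x)" for x
    using smooth_on_has_deriv_fst[OF smF, of 0 x] by (simp add: linv_field_def DERIV_imp_deriv)
  have "smooth_on UNIV (\<lambda>x. deriv_fst ?F (0, x))"
    by (rule smooth_on_compose[OF open_UNIV open_UNIV smooth_on_deriv_fst[OF smF] _ subset_UNIV])
      (intro smooth_on_Pair smooth_on_const smooth_on_linear bounded_linear_ident open_UNIV)
  then have "smooth_on UNIV (linv_field gm v h)" by (simp add: eq[abs_def])
  then show ?thesis
  proof (rule test_funI[OF _ K(1)])
    fix x assume x: "x \<notin> K"
    have op: "open ((\<lambda>t::real. gm x (t *\<^sub>R v)) -` (- K))"
      using K(1) smooth_on_imp_continuous_on[OF smooth_on_line]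
      by (intro open_vimage) (auto simp: compact_imp_closed)
    have "((\<lambda>t. h (gm x (t *\<^sub>R v))) has_real_derivative 0) (at 0)"
      by (rule has_field_derivative_transform_within_open[OF DERIV_const op]) (use x K(2) in auto)
    then show "linv_field gm v h x = 0" by (simp add: linv_field_def DERIV_imp_deriv)
  qed
qed

lemma test_fun_sublap:
  assumes "test_fun h" shows "test_fun (sublap gm B h)"
proof -
  define g where "g v = linv_field gm v (linv_field gm v h)" for v
  have g: "test_fun (g v)" for v unfolding g_def by (intro test_fun_linv_field assms)
  have "\<exists>K. compact K \<and> (\<forall>x. x \<notin> K \<longrightarrow> g v x = 0)" for v
    using test_fun_support[OF g] by metis
  then obtain K where K: "\<And>v. compact (K v)" "\<And>v x. x \<notin> K v \<Longrightarrow> g v x = 0" by metis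
  have eq: "sublap gm B h = (\<lambda>x. \<Sum>v\<in>B. g v x)" by (auto simp: sublap_def g_def)
  show ?thesis
    unfolding eq
  proof (rule test_funI)
    show "smooth_on UNIV (\<lambda>x. \<Sum>v\<in>B. g v x)"
      using g by (intro smooth_on_sum) (auto simp: test_fun_def)
    show "compact (\<Union>v\<in>B. K v)" using finite_B K(1) by (intro compact_UN) auto
    show "(\<Sum>v\<in>B. g v x) = 0" if "x \<notin> (\<Union>v\<in>B. K v)" for x
      using that K(2) by (intro sum.neutral) auto
  qed
qed

section \<open>Time integrals of the heat flow\<close>

lemma heat_flow_time_continuous:
  assumes "test_fun h" shows "continuous_on {0..t} (heat_flow h x)"
proof -
  have "continuous_on {0..t} (\<lambda>t. (\<lambda>(x, t). heat_flow h x t) (x, t))"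
    by (rule continuous_on_compose2[OF heat_flow_continuous[OF assms]]) (auto intro!: continuous_intros)
  then show ?thesis by simp
qed

lemma heat_mean_time_continuous:
  fixes \<Phi> :: "'s::euclidean_space \<times> (real^'n) \<Rightarrow> real"
  assumes "smooth_on UNIV \<Phi>" "loc_supp UNIV \<Phi>"
  shows "continuous_on {0..t} (heat_mean \<Phi> \<xi>)"
proof -
  have "continuous_on {0..t} (\<lambda>t. (\<lambda>(\<xi>, t). heat_mean \<Phi> \<xi> t) (\<xi>, t))"
    by (rule continuous_on_compose2[OF heat_mean_continuous[OF assms]]) (auto intro!: continuous_intros)
  then show ?thesis by simp
qed

lemma time_integral_deriv:
  fixes \<Phi> :: "real \<times> (real^'n) \<Rightarrow> real"
  assumes "smooth_on UNIV \<Phi>" "loc_supp UNIV \<Phi>"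
  shows "((\<lambda>s. integral {0..t} (heat_mean \<Phi> s)) has_real_derivative integral {0..t} (heat_mean (deriv_fst \<Phi>) s)) (at s)"
proof -
  have "((\<lambda>s. integral (cbox 0 t) (heat_mean \<Phi> s)) has_field_derivative integral (cbox 0 t) (heat_mean (deriv_fst \<Phi>) s)) (at s within UNIV)"
  proof (rule leibniz_rule_field_derivative)
    show "((\<lambda>s. heat_mean \<Phi> s \<tau>) has_real_derivative heat_mean (deriv_fst \<Phi>) s \<tau>) (at s within UNIV)" for s \<tau>
      using heat_mean_deriv[OF assms] by simp
    show "heat_mean \<Phi> s integrable_on cbox 0 t" for s
      using heat_mean_time_continuous[OF assms] by (intro integrable_continuous) auto
    show "continuous_on (UNIV \<times> cbox 0 t) (\<lambda>(s, \<tau>). heat_mean (deriv_fst \<Phi>) s \<tau>)"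
      by (rule continuous_on_subset[OF heat_mean_continuous[OF smooth_on_deriv_fst[OF assms(1)] loc_supp_deriv_fst[OF assms(2)]]]) auto
  qed auto
  then show ?thesis by simp
qed

definition heat_flow_integral :: "(real^'n \<Rightarrow> real) \<Rightarrow> real^'n \<Rightarrow> real \<Rightarrow> real" where
  "heat_flow_integral h x t = integral {0..t} (heat_flow h x)"

text \<open>Rescaling to the fixed interval from 0 to 1 moves \<open>t\<close> into the integrand,
  so joint continuity up to \<open>t = 0\<close> follows from that of a parameter integral.\<close>

lemma heat_flow_integral_eq:
  assumes "test_fun h" "0 \<le> t"
  shows "heat_flow_integral h x t = t * integral {0..1} (\<lambda>\<tau>. heat_flow h x (t * \<tau>))"
proof (cases "t = 0")
  case True
  then show ?thesis by (simp add: heat_flow_integral_def)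
next
  case False
  then have t: "t > 0" using assms by simp
  have "heat_flow h x integrable_on {0..t}"
    by (intro integrable_continuous_real heat_flow_time_continuous assms)
  then have "(heat_flow h x has_integral heat_flow_integral h x t) (cbox 0 t)" by (simp add: heat_flow_integral_def has_integral_integral)
  from has_integral_affinity[OF this, of t 0] t
  have "((\<lambda>\<tau>. heat_flow h x (t * \<tau>)) has_integral (1 / t) * heat_flow_integral h x t) ((\<lambda>x. x / t) ` {0..t})" by simp
  moreover have "(\<lambda>x. x / t) ` {0..t} = {0..1}"
    using t image_divide_atLeastAtMost[of t 0 t] by simp
  ultimately show ?thesis using t by (simp add: integral_unique)
qed

lemma heat_flow_integral_continuous:
  assumes "test_fun h" shows "continuous_on (UNIV \<times> {0..}) (\<lambda>(x, t). heat_flow_integral h x t)"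
proof -
  have "continuous_on ((UNIV \<times> {0..}) \<times> cbox 0 1) (\<lambda>(q, \<tau>). heat_flow h (fst q) (snd q * \<tau>))"
  proof -
    have "continuous_on ((UNIV \<times> {0..}) \<times> {0..1}) (\<lambda>z::((real^'n) \<times> real) \<times> real. (\<lambda>(x, t). heat_flow h x t) (fst (fst z), snd (fst z) * snd z))"
      by (rule continuous_on_compose2[OF heat_flow_continuous[OF assms]]) (auto intro!: continuous_intros)
    then show ?thesis by (simp add: case_prod_beta')
  qed
  then have "continuous_on (UNIV \<times> {0..}) (\<lambda>q. integral (cbox 0 1) (\<lambda>\<tau>. heat_flow h (fst q) (snd q * \<tau>)))"
    by (rule integral_continuous_on_param)
  then have "continuous_on (UNIV \<times> {0..}) (\<lambda>q. snd q * integral (cbox 0 1) (\<lambda>\<tau>. heat_flow h (fst q) (snd q * \<tau>)))"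
    by (intro continuous_intros)
  then show ?thesis
    by (rule continuous_on_eq) (auto simp: heat_flow_integral_eq[OF assms])
qed

lemma heat_flow_integral_vanishing:
  assumes "test_fun h" shows "vanishing (heat_flow_integral h)"
  unfolding vanishing_def
proof (intro allI impI)
  fix T e :: real assume e: "e > 0"
  define T' where "T' = max T 0"
  have T': "T' \<ge> 0" "T \<le> T'" by (auto simp: T'_def)
  define \<eta> where "\<eta> = e / (T' + 1)"
  have \<eta>: "\<eta> > 0" "T' * \<eta> < e" using e T' by (auto simp: \<eta>_def field_simps)
  obtain R where R: "\<And>x t. 0 \<le> t \<Longrightarrow> t \<le> T' \<Longrightarrow> R \<le> norm x \<Longrightarrow> \<bar>heat_flow h x t\<bar> < \<eta>"
    using heat_flow_vanishing[OF assms] \<eta>(1) unfolding vanishing_def by metis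
  have "\<bar>heat_flow_integral h x t\<bar> < e" if "0 \<le> t" "t \<le> T" "R \<le> norm x" for x t
  proof -
    have c: "continuous_on {0..t} (heat_flow h x)"
      by (rule heat_flow_time_continuous[OF assms])
    have "norm (integral {0..t} (heat_flow h x)) \<le> \<eta> * (t - 0)"
      by (rule integral_bound[OF that(1) c]) (use R that T' in \<open>auto intro!: less_imp_le\<close>)
    also have "\<dots> \<le> T' * \<eta>" using that T' \<eta> by (simp add: mult_left_mono)
    finally show ?thesis using \<eta> by (simp add: heat_flow_integral_def)
  qed
  then show "\<exists>R. \<forall>x t. 0 \<le> t \<longrightarrow> t \<le> T \<longrightarrow> R \<le> norm x \<longrightarrow> \<bar>heat_flow_integral h x t\<bar> < e" by blast
qed

lemma heat_flow_integral_deriv: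
  assumes "test_fun h" "t > 0" shows "(heat_flow_integral h x has_real_derivative heat_flow h x t) (at t)"
proof -
  have "(heat_flow_integral h x has_real_derivative heat_flow h x t) (at t within {0..t + 1})"
    unfolding heat_flow_integral_def[abs_def] using assms heat_flow_time_continuous[OF assms(1)]
    by (intro integral_has_real_derivative) auto
  then have "(heat_flow_integral h x has_real_derivative heat_flow h x t) (at t within {0<..<t + 1})"
    by (rule has_field_derivative_subset) auto
  then show ?thesis using assms(2) at_within_open[of t "{0<..<t + 1}"] by simp
qed

text \<open>The difference of the two sides solves the heat equation with zero initial datum: the
  sub-Laplacian of the time integral is the time integral of \<open>\<partial>\<^sub>\<tau> P\<^sub>\<tau> \<L>u\<close>.\<close>

lemma duhamel:
  assumes u: "test_fun u" and t: "t \<ge> 0"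
  shows "heat_flow u x t - u x = heat_flow_integral (sublap gm B u) x t"
proof -
  define g where "g = sublap gm B u"
  have g: "test_fun g" unfolding g_def by (rule test_fun_sublap[OF u])
  define W where "W x t = heat_flow u x t - u x - heat_flow_integral g x t" for x t
  \<comment> \<open>The static term \<open>u\<close> is treated as the flow at time 0, so that its
    derivatives along the curves are also given by \<open>heat_mean\<close>.\<close>
  define c1 where "c1 x t v s = heat_mean (deriv_fst (curve u x v)) s t - heat_mean (deriv_fst (curve u x v)) s 0
      - integral {0..t} (heat_mean (deriv_fst (curve g x v)) s)" for x t v s
  define c2 where "c2 x t v = heat_mean (deriv_fst (deriv_fst (curve u x v))) 0 t - heat_mean (deriv_fst (deriv_fst (curve u x v))) 0 0
      - integral {0..t} (heat_mean (deriv_fst (deriv_fst (curve g x v))) 0)" for x t v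
  have Vc: "heat_flow_integral g (gm x (s *\<^sub>R v)) t = integral {0..t} (heat_mean (curve g x v) s)" for x v s t
    unfolding heat_flow_integral_def curve_def by (intro arg_cong[where f = "integral _"] ext) (rule heat_flow_eq_heat_mean)
  \<comment> \<open>The time integral of the sub-Laplacean of the flow of \<open>g\<close> is
    \<open>heat_flow g x t - g x\<close>, by the heat equation and the fundamental theorem of
    calculus. The sub-Laplacean of the static term is \<open>g x\<close>, so the two occurrences of
    \<open>g x\<close> cancel and the time derivative of \<open>W\<close> remains.\<close>
  have sumc2: "(\<Sum>v\<in>B. c2 x t v) = sublap gm B (\<lambda>x. heat_flow u x t) x - heat_flow g x t" if t: "t > 0" for x t
  proof -
    have "((\<lambda>\<tau>. sublap gm B (\<lambda>x. heat_flow g x \<tau>) x) has_integral heat_flow g x t - heat_flow g x 0) {0..t}"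
    proof (rule fundamental_theorem_of_calculus_interior)
      show "continuous_on {0..t} (heat_flow g x)"
        by (rule heat_flow_time_continuous[OF g])
      show "(heat_flow g x has_vector_derivative sublap gm B (\<lambda>x. heat_flow g x \<tau>) x) (at \<tau>)" if "\<tau> \<in> {0<..<t}" for \<tau>
        using heat_flow_heat[OF g] that by (simp add: has_real_derivative_iff_has_vector_derivative)
    qed (use t in simp)
    moreover have "((\<lambda>\<tau>. sublap gm B (\<lambda>x. heat_flow g x \<tau>) x) has_integral
        (\<Sum>v\<in>B. integral {0..t} (heat_mean (deriv_fst (deriv_fst (curve g x v))) 0))) {0..t}"
      unfolding sublap_heat_flow[OF g]
      by (intro has_integral_sum finite_B integrable_integral integrable_continuous_real
          heat_mean_time_continuous smooth_on_deriv_fst loc_supp_deriv_fst curve_smooth curve_supp g)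
    ultimately have "(\<Sum>v\<in>B. integral {0..t} (heat_mean (deriv_fst (deriv_fst (curve g x v))) 0)) = heat_flow g x t - heat_flow g x 0"
      by (metis has_integral_unique)
    then have "(\<Sum>v\<in>B. integral {0..t} (heat_mean (deriv_fst (deriv_fst (curve g x v))) 0)) = heat_flow g x t - g x" by simp
    moreover have "(\<Sum>v\<in>B. heat_mean (deriv_fst (deriv_fst (curve u x v))) 0 0) = g x"
      using sublap_heat_flow[OF u, of 0 x] by (simp add: g_def)
    ultimately show ?thesis by (simp add: c2_def sum_subtractf sublap_heat_flow[OF u])
  qed
  have "heat_sol W"
  proof (rule heat_solI)
    fix x :: "real^'n" and t :: real assume t: "t > 0"
    show "(W x has_real_derivative (\<Sum>v\<in>B. c2 x t v)) (at t)"
      unfolding sumc2[OF t] W_def[abs_def] using heat_flow_heat[OF u t, of x] heat_flow_integral_deriv[OF g t, of x]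
      by (auto intro!: derivative_eq_intros)
    fix v assume "v \<in> B"
    show "((\<lambda>s. W (gm x (s *\<^sub>R v)) t) has_real_derivative c1 x t v s) (at s)" for s
      unfolding W_def Vc c1_def
      using DERIV_diff[OF DERIV_diff[OF heat_flow_curve(1)[OF u, of x v t s] heat_flow_curve(1)[OF u, of x v 0 s]]
          time_integral_deriv[OF curve_smooth[OF g, of x v] curve_supp[OF g], of t s]]
      by simp
    show "(c1 x t v has_real_derivative c2 x t v) (at 0)"
      unfolding c1_def[abs_def] c2_def
      by (intro DERIV_diff heat_flow_curve u time_integral_deriv smooth_on_deriv_fst loc_supp_deriv_fst curve_smooth curve_supp g)
  qed
  moreover have "continuous_on (UNIV \<times> {0..}) (\<lambda>(x, t). W x t)"
  proof -
    have "continuous_on (UNIV \<times> {0..}) (\<lambda>q::(real^'n) \<times> real. (\<lambda>(x, t). heat_flow u x t) q - u (fst q) - (\<lambda>(x, t). heat_flow_integral g x t) q)"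
      by (intro continuous_intros heat_flow_continuous heat_flow_integral_continuous u g
          continuous_on_compose2[OF test_fun_continuous[OF u]]) auto
    then show ?thesis by (simp add: W_def case_prod_beta')
  qed
  moreover have "vanishing W"
  proof -
    have "vanishing (\<lambda>x t. u x)"
      using heat_flow_vanishing[OF u] unfolding vanishing_def by (metis heat_flow_zero order_refl)
    then show ?thesis
      unfolding W_def[abs_def] by (intro vanishing_diff heat_flow_vanishing heat_flow_integral_vanishing u g)
  qed
  moreover have "W x 0 = 0" for x by (simp add: W_def heat_flow_integral_def)
  ultimately have "W x t = 0" by (rule heat_unique[OF _ _ _ _ t])
  then show ?thesis by (simp add: W_def g_def)
qed

section \<open>Scaling and decay for large times\<close>

text \<open>A horizontal vector has only coordinates of degree 1, so a dilation multiplies it by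
  \<open>r\<close>. This makes the sub-Laplacean scale by the square of \<open>r\<close>.\<close>

lemma dil_curve:
  assumes "v \<in> B" "r > 0"
  shows "dil \<sigma> r (gm x (s *\<^sub>R v)) = gm (dil \<sigma> r x) ((r * s) *\<^sub>R v)"
proof -
  have "dil \<sigma> r (s *\<^sub>R v) = (r * s) *\<^sub>R v"
    using layer1[OF assms(1)] by (auto simp: layer_def dil_def vec_eq_iff)
  then show ?thesis using dil_mult[OF assms(2)] by simp
qed

lemma dil_norm_large:
  assumes "r > 0" obtains C where "C > 0" "\<And>x. norm x \<le> C * norm (dil \<sigma> r x)"
proof -
  obtain C where C: "C > 0" "\<And>x. norm (dil \<sigma> (1 / r) x) \<le> norm x * C"
    using bounded_linear.pos_bounded[OF bounded_linear_dil[of \<sigma> "1 / r"]] by metis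
  show thesis
  proof (rule that[OF C(1)])
    show "norm x \<le> C * norm (dil \<sigma> r x)" for x
      using C(2)[of "dil \<sigma> r x"] dil_inverse(2)[of r \<sigma> x] assms by (simp add: mult.commute)
  qed
qed

lemma test_fun_dil:
  assumes "test_fun h" "r > 0" shows "test_fun (\<lambda>x. h (dil \<sigma> r x))"
proof -
  obtain K where K: "compact K" "\<And>x. x \<notin> K \<Longrightarrow> h x = 0" using test_fun_support[OF assms(1)] by metis
  show ?thesis
  proof (rule test_funI)
    show "smooth_on UNIV (\<lambda>x. h (dil \<sigma> r x))"
      by (rule smooth_on_compose[OF open_UNIV open_UNIV _ smooth_on_linear[OF bounded_linear_dil open_UNIV] subset_UNIV])
        (use assms(1) in \<open>simp add: test_fun_def\<close>)
    show "compact (dil \<sigma> (1 / r) ` K)"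
      by (rule compact_continuous_image[OF linear_continuous_on[OF bounded_linear_dil] K(1)])
    show "h (dil \<sigma> r x) = 0" if "x \<notin> dil \<sigma> (1 / r) ` K" for x
    proof (rule K(2), rule notI)
      assume "dil \<sigma> r x \<in> K"
      from imageI[OF this, of "dil \<sigma> (1 / r)"] show False
        using that assms(2) dil_inverse(2)[of r \<sigma> x] by simp
    qed
  qed
qed

text \<open>Both sides start from \<open>f\<close>. On the right the rescaled time contributes a
  factor \<open>r\<^sup>2\<close>, and each of the two horizontal derivatives contributes
  \<open>r\<close>. The law is stated for flows because they are continuous at time 0, as
  \<open>heat_unique\<close> requires.\<close>

lemma heat_flow_scaling:
  assumes f: "test_fun f" and r: "r > 0" and t: "t \<ge> 0"
  shows "heat_flow f x t = heat_flow (\<lambda>y. f (dil \<sigma> (1 / r) y)) (dil \<sigma> r x) (r\<^sup>2 * t)"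
proof -
  define f' where "f' y = f (dil \<sigma> (1 / r) y)" for y
  have f': "test_fun f'" unfolding f'_def using test_fun_dil[OF f, of "1 / r"] r by simp
  define Y where "Y x t = heat_flow f' (dil \<sigma> r x) (r\<^sup>2 * t)" for x t
  define c1 where "c1 x t v s = r * heat_mean (deriv_fst (curve f' (dil \<sigma> r x) v)) (r * s) (r\<^sup>2 * t)" for x t v s
  define c2 where "c2 x t v = r * (r * heat_mean (deriv_fst (deriv_fst (curve f' (dil \<sigma> r x) v))) 0 (r\<^sup>2 * t))" for x t v
  have "heat_sol Y"
  proof (rule heat_solI)
    fix x :: "real^'n" and t :: real assume t: "t > 0"
    then have "r\<^sup>2 * t > 0" using r by simp
    from DERIV_chain2[where g = "\<lambda>t. r\<^sup>2 * t" and Db = "r\<^sup>2" and s = UNIV, OF heat_flow_heat[OF f' this, of "dil \<sigma> r x"]]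
    have "(Y x has_real_derivative sublap gm B (\<lambda>y. heat_flow f' y (r\<^sup>2 * t)) (dil \<sigma> r x) * r\<^sup>2) (at t)"
      unfolding Y_def[abs_def] by (auto intro!: derivative_eq_intros)
    then show "(Y x has_real_derivative (\<Sum>v\<in>B. c2 x t v)) (at t)"
      by (simp add: sublap_heat_flow[OF f'] c2_def sum_distrib_left[symmetric] power2_eq_square algebra_simps)
    fix v assume v: "v \<in> B"
    have lin: "((\<lambda>s. r * s) has_real_derivative r) (at s)" for s
      by (auto intro!: derivative_eq_intros)
    show "((\<lambda>s. Y (gm x (s *\<^sub>R v)) t) has_real_derivative c1 x t v s) (at s)" for s
      using DERIV_chain2[OF heat_flow_curve(1)[OF f', of "dil \<sigma> r x" v "r\<^sup>2 * t" "r * s"] lin]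
      by (simp add: Y_def dil_curve[OF v r] c1_def mult.commute)
    show "(c1 x t v has_real_derivative c2 x t v) (at 0)"
      unfolding c1_def[abs_def] c2_def
      using DERIV_cmult[OF DERIV_chain2[OF heat_flow_curve(2)[OF f', of "dil \<sigma> r x" v "r\<^sup>2 * t" "r * 0"] lin], of r]
      by (simp add: mult.commute)
  qed
  then have 1: "heat_sol (\<lambda>x t. heat_flow f x t - Y x t)" by (rule heat_sol_diff[OF heat_flow_heat_sol[OF f]])
  have 2: "continuous_on (UNIV \<times> {0..}) (\<lambda>(x, t). heat_flow f x t - Y x t)"
  proof -
    have "continuous_on (UNIV \<times> {0..}) (\<lambda>q::(real^'n) \<times> real. (\<lambda>(x, t). heat_flow f x t) q - (\<lambda>(x, t). heat_flow f' x t) (dil \<sigma> r (fst q), r\<^sup>2 * snd q))"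
      by (intro continuous_intros heat_flow_continuous f continuous_on_compose2[OF heat_flow_continuous[OF f']]
          bounded_linear.continuous_on[OF bounded_linear_dil]) auto
    then show ?thesis by (simp add: Y_def case_prod_beta')
  qed
  have 3: "vanishing (\<lambda>x t. heat_flow f x t - Y x t)"
  proof (rule vanishing_diff[OF heat_flow_vanishing[OF f]], unfold vanishing_def, intro allI impI)
    fix T e :: real assume "e > 0"
    then obtain R where R: "\<And>x t. 0 \<le> t \<Longrightarrow> t \<le> r\<^sup>2 * T \<Longrightarrow> R \<le> norm x \<Longrightarrow> \<bar>heat_flow f' x t\<bar> < e"
      using heat_flow_vanishing[OF f'] unfolding vanishing_def by metis
    obtain C where C: "C > 0" "\<And>x. norm x \<le> C * norm (dil \<sigma> r x)" using dil_norm_large[OF r] by metis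
    have "\<bar>Y x t\<bar> < e" if "0 \<le> t" "t \<le> T" "C * R \<le> norm x" for x t
    proof -
      have "C * R \<le> C * norm (dil \<sigma> r x)" using that C(2)[of x] by simp
      then have "R \<le> norm (dil \<sigma> r x)" using C(1) by simp
      then show ?thesis unfolding Y_def using that r by (intro R) (auto simp: mult_left_mono)
    qed
    then show "\<exists>R. \<forall>x t. 0 \<le> t \<longrightarrow> t \<le> T \<longrightarrow> R \<le> norm x \<longrightarrow> \<bar>Y x t\<bar> < e" by blast
  qed
  have 4: "heat_flow f x 0 - Y x 0 = 0" for x
    using dil_inverse(2)[of r \<sigma> x] r by (simp add: Y_def f'_def)
  from heat_unique[OF 1 2 3 4 t, of x] show ?thesis by (simp add: Y_def f'_def[abs_def])
qed

text \<open>Time 1 suffices, since scaling carries every positive time to 1.\<close>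

lemma heat_kernel_bounded: obtains C where "C > 0" "\<And>x. p x 1 \<le> C"
proof -
  have "eventually (\<lambda>q. dist (case q of (x, t) \<Rightarrow> p x t) 0 < 1) at_infinity"
    by (rule tendstoD[OF p_lim zero_less_one])
  then obtain b where b: "\<And>x t. norm (x, t) \<ge> b \<Longrightarrow> p x t < 1"
    unfolding eventually_at_infinity by (auto simp: p_nonneg)
  have "continuous_on (cball 0 b) (\<lambda>x. p x 1)" by (intro continuous_on_p continuous_intros) auto
  then have "bounded ((\<lambda>x. p x 1) ` cball 0 b)"
    using compact_continuous_image compact_imp_bounded compact_cball by blast
  then obtain C where C: "C > 0" "\<And>x. x \<in> cball 0 b \<Longrightarrow> norm (p x 1) \<le> C"
    unfolding bounded_pos by auto
  have "p x 1 \<le> max C 1" for x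
  proof (cases "x \<in> cball 0 b")
    case True
    then show ?thesis using C(2)[OF True] by simp
  next
    case False
    then have "norm (x, 1::real) \<ge> b" using norm_fst_le[of x "1::real"] by simp
    then show ?thesis using b[of x 1] by simp
  qed
  then show thesis using that[of "max C 1"] by simp
qed

lemma dil_integral:
  fixes h :: "real^'n \<Rightarrow> real"
  assumes "h \<in> borel_measurable borel" "r > 0"
  shows "(LINT y|lborel. h (dil \<sigma> r y)) = (1 / r ^ (\<Sum>i\<in>UNIV. \<sigma> i)) * (LINT y|lborel. h y)"
proof -
  let ?Q = "\<Sum>i\<in>UNIV. \<sigma> i"
  \<comment> \<open>The scaling factor of a basis vector is read off from its coordinate index,
    since \<open>lborel_affine_euclidean\<close> takes factors indexed by basis vectors.\<close>
  define c where "c b = r ^ \<sigma> (THE i. b = axis i 1)" for b :: "real^'n"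
  have c: "c (axis i 1) = r ^ \<sigma> i" for i by (simp add: c_def axis_eq_axis)
  have cne: "c b \<noteq> 0" for b using assms(2) by (simp add: c_def)
  have T: "(\<Sum>b\<in>Basis. (c b * (y \<bullet> b)) *\<^sub>R b) = dil \<sigma> r y" for y
  proof -
    have "(\<Sum>b\<in>Basis. (c b * (y \<bullet> b)) *\<^sub>R b) = (\<Sum>b\<in>Basis. (dil \<sigma> r y \<bullet> b) *\<^sub>R b)"
      by (intro sum.cong refl) (auto simp: Basis_vec_def c inner_axis dil_def)
    then show ?thesis by (simp add: euclidean_representation)
  qed
  have "(\<Prod>b\<in>Basis. \<bar>c b\<bar>) = r ^ ?Q"
    using assms(2) by (simp add: prod_Basis_vec c power_sum)
  then have "lborel = density (distr lborel borel (dil \<sigma> r)) (\<lambda>_. ennreal (r ^ ?Q))"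
    using lborel_affine_euclidean[of c "0 :: real^'n"] cne by (simp add: T)
  then have "(LINT y|lborel. h y) = (LINT y|density (distr lborel borel (dil \<sigma> r)) (\<lambda>_. ennreal (r ^ ?Q)). h y)"
    by simp
  also have "\<dots> = r ^ ?Q * (LINT y|lborel. h (dil \<sigma> r y))"
    using assms linear_continuous_on[OF bounded_linear_dil, of UNIV \<sigma> r]
    by (subst integral_density) (auto simp: integral_distr borel_measurable_continuous_onI)
  finally show ?thesis using assms(2) by simp
qed

text \<open>Scaling with \<open>r = 1 / sqrt t\<close> turns time \<open>t\<close> into time 1 and
  \<open>f\<close> into its dilate by \<open>sqrt t\<close>. At time 1 the flow is at most the bound
  of the kernel times the integral of that dilate, and the Jacobian of the dilation supplies the
  power of \<open>sqrt t\<close>.\<close>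

lemma heat_flow_decay:
  assumes f: "test_fun f" "\<And>x. f x \<ge> 0"
  obtains C where "C > 0" "\<And>x t. t > 0 \<Longrightarrow> heat_flow f x t \<le> C * sqrt t powr (- real (\<Sum>i\<in>UNIV. \<sigma> i))"
proof -
  let ?Q = "\<Sum>i\<in>UNIV. \<sigma> i"
  obtain C where C: "C > 0" "\<And>x. p x 1 \<le> C" using heat_kernel_bounded by metis
  note cf = test_fun_continuous[OF f(1)]
  define I where "I = (LINT y|lborel. f y)"
  have I: "I \<ge> 0" unfolding I_def using f(2) by simp
  have bound: "heat_flow h x 1 \<le> C * (LINT y|lborel. h y)" if h: "test_fun h" "\<And>x. h x \<ge> 0" for h x
  proof -
    obtain K where K: "compact K" "\<And>x. x \<notin> K \<Longrightarrow> h x = 0" using test_fun_support[OF h(1)] by metis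
    obtain a where a: "K \<subseteq> cbox (- a) a"
      using bounded_subset_cbox_symmetric[OF compact_imp_bounded[OF K(1)]] by metis
    note ch = test_fun_continuous[OF h(1)]
    have ih: "integrable lborel h"
      by (rule compact_support_integral(1)[OF ch, of "- a" a]) (use K a in auto)
    have "integrable lborel (\<lambda>y. p (gm (ginv y) x) 1 * h y)"
      by (rule compact_support_integral(1)[of _ "- a" a])
        (use ch K a in \<open>auto intro!: continuous_intros continuous_on_p\<close>)
    then have "(LINT y|lborel. p (gm (ginv y) x) 1 * h y) \<le> (LINT y|lborel. C * h y)"
      using ih C(2) h(2) by (intro integral_mono) (auto intro!: mult_right_mono)
    then show ?thesis using ch by (simp add: heat_flow_eq_semigroup heat_semigroup_def)
  qed
  \<comment> \<open>\<open>I + 1\<close> in place of \<open>I\<close> keeps the constant positive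
    when \<open>f\<close> is zero.\<close>
  have "heat_flow f x t \<le> (C * (I + 1)) * sqrt t powr (- real ?Q)" if t: "t > 0" for x t
  proof -
    define r where "r = 1 / sqrt t"
    have r: "r > 0" "r\<^sup>2 * t = 1" "1 / r = sqrt t" using t by (auto simp: r_def power_divide)
    have "heat_flow f x t = heat_flow (\<lambda>y. f (dil \<sigma> (sqrt t) y)) (dil \<sigma> r x) 1"
      using heat_flow_scaling[OF f(1) r(1), of t x] t r by simp
    also have "\<dots> \<le> C * (LINT y|lborel. f (dil \<sigma> (sqrt t) y))"
      by (rule bound[OF test_fun_dil[OF f(1)]]) (use t f(2) in auto)
    also have "\<dots> = C * (1 / sqrt t ^ ?Q * I)"
      using dil_integral[OF borel_measurable_continuous_onI[OF cf], of "sqrt t"] t by (simp add: I_def)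
    also have "\<dots> \<le> C * (1 / sqrt t ^ ?Q * (I + 1))"
      using C(1) t by (intro mult_left_mono) auto
    also have "1 / sqrt t ^ ?Q = sqrt t powr (- real ?Q)"
      using t by (simp add: powr_minus powr_realpow[symmetric] divide_inverse)
    finally show ?thesis by (simp add: mult_ac)
  qed
  then show thesis using that[of "C * (I + 1)"] C(1) I by simp
qed

end

section \<open>The two integrals\<close>

lemma set_integrable_two_powers:
  fixes f :: "real \<Rightarrow> real"
  assumes cont: "continuous_on {0<..} f" and ab: "a > -1" "b < -1"
    and le1: "\<And>t. 0 < t \<Longrightarrow> t \<le> 1 \<Longrightarrow> \<bar>f t\<bar> \<le> M * t powr a"
    and ge1: "\<And>t. 1 \<le> t \<Longrightarrow> \<bar>f t\<bar> \<le> M * t powr b"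
  shows "set_integrable lborel {0<..} f"
proof -
  have i1: "integrable lborel (\<lambda>t. indicator {0..1} t *\<^sub>R t powr a)"
  proof -
    have "(\<lambda>t. t powr a) integrable_on {0..1::real}" by (rule integrable_on_powr_from_0) (use ab in auto)
    then have "(\<lambda>t. t powr a) absolutely_integrable_on {0..1::real}"
      by (rule nonnegative_absolutely_integrable_1) simp
    then show ?thesis unfolding set_integrable_def by (subst (asm) integrable_completion) auto
  qed
  have i2: "integrable lborel (\<lambda>t. indicator {1..} t *\<^sub>R t powr b)"
  proof -
    have "(\<lambda>t. t powr b) integrable_on {1::real..}"
      using has_integral_powr_to_inf[OF ab(2) zero_less_one] by blast
    then have "(\<lambda>t. t powr b) absolutely_integrable_on {1::real..}"
      by (rule nonnegative_absolutely_integrable_1) simp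
    then show ?thesis unfolding set_integrable_def by (subst (asm) integrable_completion) auto
  qed
  show ?thesis
    unfolding set_integrable_def
  proof (rule Bochner_Integration.integrable_bound)
    show "integrable lborel (\<lambda>t. M * (indicator {0..1} t *\<^sub>R t powr a) + M * (indicator {1..} t *\<^sub>R t powr b))"
      using i1 i2 by simp
    show "(\<lambda>t. indicator {0<..} t *\<^sub>R f t) \<in> borel_measurable lborel"
      using borel_measurable_continuous_on_indicator[OF _ cont] by simp
    have M: "M \<ge> 0" using ge1[of 1] abs_ge_zero[of "f 1"] by simp
    have "norm (indicator {0<..} t *\<^sub>R f t)
        \<le> norm (M * (indicator {0..1} t *\<^sub>R t powr a) + M * (indicator {1..} t *\<^sub>R t powr b))" for t
      using le1[of t] ge1[of t] M by (auto simp: indicator_def)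
    then show "AE t in lborel. norm (indicator {0<..} t *\<^sub>R f t)
        \<le> norm (M * (indicator {0..1} t *\<^sub>R t powr a) + M * (indicator {1..} t *\<^sub>R t powr b))" by simp
  qed
qed

text \<open>The absolute value of \<open>g\<close> need not be smooth, so a nonnegative test
  function \<open>h\<close> is put above it. Dimension at least 3 and degrees at least 1 give
  homogeneous dimension at least 3, whence the exponent \<open>- 3 / 2\<close> for
  \<open>t \<ge> 1\<close>. For \<open>t \<le> 1\<close> the bound comes from continuity in time at
  the given \<open>x\<close>, so \<open>N\<close> may depend on \<open>x\<close>.\<close>

lemma (in carnot_heat) heat_flow_bounds:
  assumes Q: "CARD('n) \<ge> 3" and g: "test_fun g"
  obtains N h where "test_fun h" "\<And>y. \<bar>g y\<bar> \<le> h y" "N > 0"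
    "\<And>t. 0 \<le> t \<Longrightarrow> heat_flow h x t \<le> N" "\<And>t. 1 \<le> t \<Longrightarrow> heat_flow h x t \<le> N * t powr (- 3 / 2)"
proof -
  obtain K where K: "compact K" "\<And>y. y \<notin> K \<Longrightarrow> g y = 0" using test_fun_support[OF g] by metis
  obtain \<phi> where \<phi>: "test_fun \<phi>" "\<And>x. 0 \<le> \<phi> x" "\<And>x. x \<in> K \<Longrightarrow> 1 \<le> \<phi> x"
    using bump_fun_exists[OF K(1)] by metis
  have "bounded (g ` K)"
    using compact_continuous_image[OF continuous_on_subset[OF test_fun_continuous[OF g]] K(1)]
      compact_imp_bounded by auto
  then obtain c where c: "c > 0" "\<And>y. y \<in> K \<Longrightarrow> \<bar>g y\<bar> \<le> c" unfolding bounded_pos by auto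
  define h where "h y = c * \<phi> y" for y
  obtain K' where K': "compact K'" "\<And>y. y \<notin> K' \<Longrightarrow> \<phi> y = 0" using test_fun_support[OF \<phi>(1)] by metis
  have h: "test_fun h"
  proof (rule test_funI[OF _ K'(1)])
    show "smooth_on UNIV h"
      unfolding h_def[abs_def] using \<phi>(1) by (intro smooth_on_mult smooth_on_const) (auto simp: test_fun_def)
  qed (use K' in \<open>simp add: h_def\<close>)
  have h0: "h y \<ge> 0" for y using c(1) \<phi>(2) by (simp add: h_def)
  have gh: "\<bar>g y\<bar> \<le> h y" for y
  proof (cases "y \<in> K")
    case True
    then have "c * 1 \<le> c * \<phi> y" using c(1) \<phi>(3) by (intro mult_left_mono) auto
    then show ?thesis using c(2)[OF True] by (simp add: h_def)
  next
    case False
    then show ?thesis using K(2) h0 by simp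
  qed
  obtain C where C: "C > 0" "\<And>x t. t > 0 \<Longrightarrow> heat_flow h x t \<le> C * sqrt t powr (- real (\<Sum>i\<in>UNIV. \<sigma> i))"
    using heat_flow_decay[OF h h0] by metis
  have "(\<Sum>i\<in>(UNIV :: 'n set). 1) \<le> (\<Sum>i\<in>UNIV. \<sigma> i)" by (intro sum_mono degree_pos)
  then have "3 \<le> (\<Sum>i\<in>UNIV. \<sigma> i)" using Q by simp
  then have Q3: "3 \<le> real (\<Sum>i\<in>UNIV. \<sigma> i)" by (metis of_nat_le_iff of_nat_numeral)
  have b1: "heat_flow h x t \<le> C * t powr (- 3 / 2)" if "1 \<le> t" for t
  proof -
    have "sqrt t powr (- real (\<Sum>i\<in>UNIV. \<sigma> i)) \<le> sqrt t powr (- 3)"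
      using that Q3 by (intro powr_mono) auto
    also have "\<dots> = t powr (- 3 / 2)"
      using that powr_powr[of t "1 / 2" "- 3"] powr_half_sqrt[of t] by simp
    finally have "C * sqrt t powr (- real (\<Sum>i\<in>UNIV. \<sigma> i)) \<le> C * t powr (- 3 / 2)"
      by (rule mult_left_mono) (use C(1) in simp)
    moreover have "heat_flow h x t \<le> C * sqrt t powr (- real (\<Sum>i\<in>UNIV. \<sigma> i))"
      by (rule C(2)) (use that in simp)
    ultimately show ?thesis by (rule order_trans[rotated])
  qed
  have "bounded (heat_flow h x ` {0..1})"
    by (intro compact_imp_bounded compact_continuous_image heat_flow_time_continuous h) simp
  then obtain M where M: "M > 0" "\<And>t. t \<in> {0..1} \<Longrightarrow> \<bar>heat_flow h x t\<bar> \<le> M" unfolding bounded_pos by auto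
  show thesis
  proof (rule that[OF h gh, of "max M C"])
    show "heat_flow h x t \<le> max M C" if "0 \<le> t" for t
    proof (cases "t \<le> 1")
      case True
      then show ?thesis using M(2)[of t] that by auto
    next
      case False
      then have "t powr (- 3 / 2) \<le> t powr 0" by (intro powr_mono) auto
      then have "C * t powr (- 3 / 2) \<le> C * 1" using C(1) False by (intro mult_left_mono) auto
      then show ?thesis using b1[of t] False by simp
    qed
    show "heat_flow h x t \<le> max M C * t powr (- 3 / 2)" if "1 \<le> t" for t
      using b1[OF that] mult_right_mono[of C "max M C" "t powr (- 3 / 2)"] by simp
  qed (use C in auto)
qed

lemma (in carnot_heat) heat_flow_dominated:
  assumes g: "test_fun g" and h: "test_fun h" "\<And>y. \<bar>g y\<bar> \<le> h y" and t: "t > 0"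
  shows "integrable lborel (\<lambda>y. p (gm (ginv y) x) t * g y)"
    "(LINT y|lborel. \<bar>p (gm (ginv y) x) t * g y\<bar>) \<le> heat_flow h x t" "\<bar>heat_flow g x t\<bar> \<le> heat_flow h x t"
proof -
  have int: "integrable lborel (\<lambda>y. p (gm (ginv y) x) t * f y)" if f: "test_fun f" for f
  proof -
    obtain K where K: "compact K" "\<And>y. y \<notin> K \<Longrightarrow> f y = 0" using test_fun_support[OF f] by metis
    obtain a where a: "K \<subseteq> cbox (- a) a"
      using bounded_subset_cbox_symmetric[OF compact_imp_bounded[OF K(1)]] by metis
    show ?thesis
      by (rule compact_support_integral(1)[of _ "- a" a])
        (use test_fun_continuous[OF f] K a t in \<open>auto intro!: continuous_intros continuous_on_p\<close>)
  qed
  show "integrable lborel (\<lambda>y. p (gm (ginv y) x) t * g y)" by (rule int[OF g])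
  have "(LINT y|lborel. \<bar>p (gm (ginv y) x) t * g y\<bar>) \<le> (LINT y|lborel. p (gm (ginv y) x) t * h y)"
    by (rule integral_mono[OF integrable_abs[OF int[OF g]] int[OF h(1)]])
      (use h(2) in \<open>auto simp: abs_mult p_nonneg intro!: mult_left_mono\<close>)
  then show *: "(LINT y|lborel. \<bar>p (gm (ginv y) x) t * g y\<bar>) \<le> heat_flow h x t"
    by (simp add: heat_flow_eq_semigroup[OF t test_fun_continuous[OF h(1)]] heat_semigroup_def)
  have "\<bar>heat_flow g x t\<bar> \<le> (LINT y|lborel. \<bar>p (gm (ginv y) x) t * g y\<bar>)"
    by (simp add: heat_flow_eq_semigroup[OF t test_fun_continuous[OF g]] heat_semigroup_def)
  with * show "\<bar>heat_flow g x t\<bar> \<le> heat_flow h x t" by simp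
qed

lemma (in carnot_heat) fractional_sublaplacian:
  assumes Q: "CARD('n) \<ge> 3" and s: "0 < s" "s < 1" and u: "test_fun u"
  defines "g \<equiv> sublap gm B u" and "R \<equiv> riesz_kernel p (2 - 2 * s)"
  shows "set_integrable lborel {0<..} (\<lambda>t. t powr (- s - 1) * (heat_semigroup gm ginv p t u x - u x))"
    "integrable lborel (\<lambda>y. g y * R (gm (ginv y) x))"
    "s / Gamma (1 - s) * (LINT t:{0<..}|lborel. t powr (- s - 1) * (heat_semigroup gm ginv p t u x - u x))
      = (LINT y|lborel. g y * R (gm (ginv y) x))"
proof -
  have g: "test_fun g" unfolding g_def by (rule test_fun_sublap[OF u])
  note cg = test_fun_continuous[OF g]
  obtain N h where h: "test_fun h" "\<And>y. \<bar>g y\<bar> \<le> h y" "N > 0"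
    "\<And>t. 0 \<le> t \<Longrightarrow> heat_flow h x t \<le> N" "\<And>t. 1 \<le> t \<Longrightarrow> heat_flow h x t \<le> N * t powr (- 3 / 2)"
    using heat_flow_bounds[OF Q g, of x] by metis
  obtain N' h' where h': "test_fun h'" "\<And>y. \<bar>u y\<bar> \<le> h' y" "N' > 0" "\<And>t. 0 \<le> t \<Longrightarrow> heat_flow h' x t \<le> N'"
    using heat_flow_bounds[OF Q u, of x] by metis
  note Uh = heat_flow_dominated[OF g h(1,2), of _ x]
  have contU: "continuous_on {0<..} (heat_flow f x)" if "test_fun f" for f
    by (intro continuous_at_imp_continuous_on ballI DERIV_isCont[OF heat_flow_heat[OF that]]) auto
  define a where "a t = heat_flow u x t - u x" for t
  have a_eq: "a t = heat_semigroup gm ginv p t u x - u x" if "t > 0" for t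
    by (simp add: a_def heat_flow_eq_semigroup[OF that test_fun_continuous[OF u]])
  have a_eq_integral: "a t = heat_flow_integral g x t" if "t \<ge> 0" for t
    unfolding a_def g_def by (rule duhamel[OF u that])
  have a_deriv: "(a has_real_derivative heat_flow g x t) (at t)" if "t > 0" for t
    using has_field_derivative_transform_within_open[OF heat_flow_integral_deriv[OF g that, of x], of "{0<..}" a] a_eq_integral that by simp
  have a_cont: "continuous_on {0<..} a"
    by (intro continuous_at_imp_continuous_on ballI DERIV_isCont[OF a_deriv]) auto
  \<comment> \<open>The Duhamel formula gives one power of \<open>t\<close>, so near 0 the integrand
    of the first definition is bounded by a multiple of \<open>t powr (- s)\<close>, which is
    integrable since \<open>s < 1\<close>.\<close>
  have a_small: "\<bar>a t\<bar> \<le> N * t" if t: "t > 0" for t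
  proof -
    \<comment> \<open>\<open>heat_flow_dominated\<close> speaks of positive times; at
      \<open>\<tau> = 0\<close> the bound reads
      \<open>\<bar>g x\<bar> \<le> h x \<le> N\<close>.\<close>
    have "norm (heat_flow g x \<tau>) \<le> N" if "\<tau> \<in> {0..t}" for \<tau>
      using Uh(3)[of \<tau>] h(2)[of x] h(4)[of \<tau>] that by (cases "\<tau> = 0") auto
    then have "norm (heat_flow_integral g x t) \<le> N * (t - 0)"
      unfolding heat_flow_integral_def using t by (intro integral_bound heat_flow_time_continuous g) auto
    then show ?thesis using a_eq_integral[of t] t by simp
  qed
  define L where "L = N' + \<bar>u x\<bar>"
  have L: "L > 0" using h'(3) by (simp add: L_def)
  \<comment> \<open>For large \<open>t\<close> boundedness suffices, because
    \<open>t powr (- s - 1)\<close> is integrable there.\<close>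
  have a_bdd: "\<bar>a t\<bar> \<le> L" if "t > 0" for t
    using heat_flow_dominated(3)[OF u h'(1,2) that, of x] h'(4)[of t] that by (simp add: a_def L_def)
  have powr_minus1: "t powr (- s - 1) * t = t powr (- s)" if "t > 0" for t
    using that powr_add[of t "- s - 1" 1] by simp

  have int1: "set_integrable lborel {0<..} (\<lambda>t. t powr (- s - 1) * a t)"
  proof (rule set_integrable_two_powers[where a = "- s" and b = "- s - 1" and M = "max N L"])
    show "continuous_on {0<..} (\<lambda>t. t powr (- s - 1) * a t)"
      by (intro continuous_intros a_cont) auto
    show "\<bar>t powr (- s - 1) * a t\<bar> \<le> max N L * t powr (- s)" if t: "0 < t" for t
    proof -
      have "\<bar>t powr (- s - 1) * a t\<bar> \<le> t powr (- s - 1) * (N * t)"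
        using a_small[OF t] by (simp add: abs_mult mult_left_mono)
      also have "\<dots> = N * t powr (- s)" using powr_minus1[OF t] by (simp add: mult_ac)
      also have "\<dots> \<le> max N L * t powr (- s)" by (intro mult_right_mono) auto
      finally show ?thesis .
    qed
    show "\<bar>t powr (- s - 1) * a t\<bar> \<le> max N L * t powr (- s - 1)" if t: "1 \<le> t" for t
    proof -
      have "\<bar>t powr (- s - 1) * a t\<bar> \<le> t powr (- s - 1) * L"
        using a_bdd[of t] t by (simp add: abs_mult mult_left_mono)
      also have "\<dots> \<le> max N L * t powr (- s - 1)"
        by (subst mult.commute) (intro mult_right_mono, auto)
      finally show ?thesis .
    qed
  qed (use s in auto)

  have int2: "set_integrable lborel {0<..} (\<lambda>t. t powr (- s) * heat_flow f x t)"
    if f: "test_fun f" "\<And>t. t > 0 \<Longrightarrow> \<bar>heat_flow f x t\<bar> \<le> heat_flow h x t" for f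
  proof (rule set_integrable_two_powers[where a = "- s" and b = "- s - 3 / 2" and M = N])
    show "continuous_on {0<..} (\<lambda>t. t powr (- s) * heat_flow f x t)"
      by (intro continuous_intros contU f) auto
    show "\<bar>t powr (- s) * heat_flow f x t\<bar> \<le> N * t powr (- s)" if t: "0 < t" for t
      using f(2)[OF t] h(4)[of t] t by (simp add: abs_mult mult.commute mult_right_mono)
    show "\<bar>t powr (- s) * heat_flow f x t\<bar> \<le> N * t powr (- s - 3 / 2)" if t: "1 \<le> t" for t
    proof -
      have "\<bar>t powr (- s) * heat_flow f x t\<bar> \<le> t powr (- s) * (N * t powr (- 3 / 2))"
        using f(2)[of t] h(5)[of t] t by (simp add: abs_mult mult_left_mono)
      also have "\<dots> = N * t powr (- s - 3 / 2)"
        using powr_add[of t "- s" "- 3 / 2"] by simp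
      finally show ?thesis .
    qed
  qed (use s in auto)
  note int2g = int2[OF g Uh(3)]
  have Uh_nonneg: "0 \<le> heat_flow h x t" if "t > 0" for t
    using Uh(3)[OF that] by linarith
  have int2h: "set_integrable lborel {0<..} (\<lambda>t. t powr (- s) * heat_flow h x t)"
    using int2[OF h(1)] Uh_nonneg by simp

  have parts: "s * (LINT t:{0<..}|lborel. t powr (- s - 1) * a t) = (LINT t:{0<..}|lborel. t powr (- s) * heat_flow g x t)"
  proof -
    \<comment> \<open>Integration by parts as one application of the fundamental theorem:
      \<open>?f\<close> is the derivative of \<open>t powr (- s) * a t\<close>. This primitive tends
      to 0 at both ends, being bounded by \<open>N * t powr (1 - s)\<close> and by
      \<open>L * t powr (- s)\<close>.\<close>
    let ?f = "\<lambda>t. t powr (- s) * heat_flow g x t - s * (t powr (- s - 1) * a t)"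
    have int: "set_integrable lborel {0<..} ?f"
      using set_integral_diff(1)[OF int2g set_integrable_mult_right[of s, OF int1]] .
    have ein: "einterval 0 \<infinity> = {0<..}" by (auto simp: einterval_def zero_ereal_def)
    have "(LBINT t=0..\<infinity>. ?f t) = 0 - 0"
    proof (rule interval_integral_FTC_integrable[where F = "\<lambda>t. t powr (- s) * a t"])
      show "((\<lambda>t. t powr (- s) * a t) has_vector_derivative ?f t) (at t)" if "0 < ereal t" for t
      proof -
        have t: "t > 0" using that by (simp add: zero_ereal_def)
        have "((\<lambda>t. t powr (- s) * a t) has_real_derivative ?f t) (at t)"
          using a_deriv[OF t] t by (auto intro!: derivative_eq_intros simp: algebra_simps)
        then show ?thesis by (simp add: has_real_derivative_iff_has_vector_derivative)
      qed
      show "isCont ?f t" if "0 < ereal t" for t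
      proof -
        have t: "t > 0" using that by (simp add: zero_ereal_def)
        have "continuous_on {0<..} ?f" by (intro continuous_intros contU g a_cont) auto
        then show ?thesis using t by (simp add: continuous_on_eq_continuous_at)
      qed
      show "set_integrable lborel (einterval 0 \<infinity>) ?f" using int by (simp add: ein)
      have "((\<lambda>t. t powr (- s) * a t) \<longlongrightarrow> 0) (at_right 0)"
      proof (rule Lim_null_comparison)
        have "((\<lambda>t. N * t powr (1 - s)) \<longlongrightarrow> N * 0) (at_right (0::real))"
          using s by (intro tendsto_intros tendsto_zero_powrI[where b = "1 - s"])
            (auto simp: eventually_at_filter)
        then show "((\<lambda>t. N * t powr (1 - s)) \<longlongrightarrow> 0) (at_right (0::real))" by simp
        have "norm (t powr (- s) * a t) \<le> N * t powr (1 - s)" if t: "t > 0" for t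
        proof -
          have "norm (t powr (- s) * a t) \<le> t powr (- s) * (N * t)"
            using a_small[OF t] by (simp add: abs_mult mult_left_mono)
          also have "\<dots> = N * t powr (1 - s)" using t powr_add[of t "- s" 1] by simp
          finally show ?thesis .
        qed
        then show "\<forall>\<^sub>F t in at_right 0. norm (t powr (- s) * a t) \<le> N * t powr (1 - s)"
          by (auto simp: eventually_at_filter)
      qed
      then show "(((\<lambda>t. t powr (- s) * a t) \<circ> real_of_ereal) \<longlongrightarrow> 0) (at_right 0)"
        by (simp add: zero_ereal_def ereal_tendsto_simps)
      have "((\<lambda>t. t powr (- s) * a t) \<longlongrightarrow> 0) at_top"
      proof (rule Lim_null_comparison)
        have "((\<lambda>t. L * t powr (- s)) \<longlongrightarrow> L * 0) at_top"
          using s by (intro tendsto_intros tendsto_neg_powr filterlim_ident) auto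
        then show "((\<lambda>t. L * t powr (- s)) \<longlongrightarrow> 0) at_top" by simp
        show "\<forall>\<^sub>F t in at_top. norm (t powr (- s) * a t) \<le> L * t powr (- s)"
          using eventually_gt_at_top[of 0]
        proof eventually_elim
          case (elim t)
          then show ?case using a_bdd[of t] by (simp add: abs_mult mult.commute mult_right_mono)
        qed
      qed
      then show "(((\<lambda>t. t powr (- s) * a t) \<circ> real_of_ereal) \<longlongrightarrow> 0) (at_left \<infinity>)"
        by (simp add: ereal_tendsto_simps)
    qed simp
    then have "(LINT t:{0<..}|lborel. ?f t) = 0"
      by (simp add: zero_ereal_def interval_integral_to_infinity_eq)
    then show ?thesis
      using set_integral_diff(2)[OF int2g set_integrable_mult_right[of s, OF int1]] by simp
  qed

  define H where "H t y = indicator {0<..} t * (t powr (- s) * (p (gm (ginv y) x) t * g y))" for t y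
  have H_meas: "case_prod H \<in> borel_measurable (lborel \<Otimes>\<^sub>M lborel)"
  proof -
    have "continuous_on ({0<..} \<times> UNIV) (\<lambda>q. fst q powr (- s) * (p (gm (ginv (snd q)) x) (fst q) * g (snd q)))"
      by (intro continuous_intros continuous_on_p continuous_on_compose2[OF cg]) auto
    from borel_measurable_continuous_on_indicator[OF _ this]
    have "(\<lambda>q. indicator ({0<..} \<times> UNIV) q *\<^sub>R (fst q powr (- s) * (p (gm (ginv (snd q)) x) (fst q) * g (snd q)))) \<in> borel_measurable borel"
      by (simp add: open_Times)
    moreover have "(\<lambda>q. indicator ({0<..} \<times> UNIV) q *\<^sub>R (fst q powr (- s) * (p (gm (ginv (snd q)) x) (fst q) * g (snd q)))) = case_prod H"
      by (auto simp: H_def indicator_def fun_eq_iff)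
    ultimately show ?thesis by (simp add: lborel_prod)
  qed
  \<comment> \<open>Integrating the absolute value in \<open>y\<close> first leaves at most
    \<open>t powr (- s) * heat_flow h x t\<close>, which is integrable in \<open>t\<close> by
    \<open>int2h\<close>.\<close>
  have H_int: "integrable (lborel \<Otimes>\<^sub>M lborel) (case_prod H)"
  proof (rule lborel_pair.Fubini_integrable[OF H_meas])
    show "AE t in lborel. integrable lborel (\<lambda>y. case (t, y) of (x, xa) \<Rightarrow> H x xa)"
      using Uh(1) by (auto simp: H_def indicator_def)
    show "integrable lborel (\<lambda>t. LINT y|lborel. norm (case (t, y) of (x, xa) \<Rightarrow> H x xa))"
    proof (rule Bochner_Integration.integrable_bound[OF int2h[unfolded set_integrable_def]])
      have "(\<lambda>q. norm (case_prod H q)) \<in> borel_measurable (lborel \<Otimes>\<^sub>M lborel)"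
        using H_meas by measurable
      then show "(\<lambda>t. LINT y|lborel. norm (case (t, y) of (x, xa) \<Rightarrow> H x xa)) \<in> borel_measurable lborel"
        by (intro lborel.borel_measurable_lebesgue_integral) (simp add: case_prod_beta')
      have "norm (LINT y|lborel. norm (case (t, y) of (x, xa) \<Rightarrow> H x xa))
          \<le> norm (indicator {0<..} t *\<^sub>R (t powr (- s) * heat_flow h x t))" for t
      proof (cases "t > 0")
        case True
        have "(LINT y|lborel. norm (H t y)) = t powr (- s) * (LINT y|lborel. \<bar>p (gm (ginv y) x) t * g y\<bar>)"
          using True by (simp add: H_def abs_mult)
        also have "\<dots> \<le> t powr (- s) * heat_flow h x t" using Uh(2)[OF True] by (intro mult_left_mono) auto
        finally show ?thesis
          using True Uh_nonneg[OF True] Bochner_Integration.integral_nonneg_AE[of "\<lambda>y. norm (H t y)" lborel] by simp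
      qed (simp add: H_def)
      then show "AE t in lborel. norm (LINT y|lborel. norm (case (t, y) of (x, xa) \<Rightarrow> H x xa))
          \<le> norm (indicator {0<..} t *\<^sub>R (t powr (- s) * heat_flow h x t))" by simp
    qed
  qed
  have \<Gamma>: "Gamma (1 - s) > 0" using s by (intro Gamma_real_pos) simp
  \<comment> \<open>For \<open>\<beta> = 2 - 2 * s\<close> the weight of the Riesz kernel is
    \<open>t powr (- s)\<close> and its normalisation is \<open>Gamma (1 - s)\<close>. The identity
    holds for every \<open>y\<close>: where the Riesz integral diverges it has the default value 0,
    and so has the left side.\<close>
  have H_R: "(LINT t|lborel. H t y) = Gamma (1 - s) * (g y * R (gm (ginv y) x))" for y
  proof -
    have "(LINT t|lborel. H t y) = (LINT t|lborel. g y * (indicator {0<..} t *\<^sub>R (t powr ((2 - 2 * s) / 2) * p (gm (ginv y) x) t / t)))"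
    proof (rule Bochner_Integration.integral_cong[OF refl])
      fix t :: real
      have "t powr ((2 - 2 * s) / 2) / t = t powr (- s)" if "t > 0"
        using that powr_diff[of t "1 - s" 1] by (simp add: diff_divide_distrib)
      then show "H t y = g y * (indicator {0<..} t *\<^sub>R (t powr ((2 - 2 * s) / 2) * p (gm (ginv y) x) t / t))"
        unfolding H_def by (cases "t > 0") (auto simp: field_simps)
    qed
    also have "\<dots> = Gamma (1 - s) * (g y * R (gm (ginv y) x))"
      unfolding integral_mult_right_zero R_def riesz_kernel_def set_lebesgue_integral_def
      using \<Gamma> by (simp add: diff_divide_distrib)
    finally show ?thesis .
  qed
  have "integrable lborel (\<lambda>y. Gamma (1 - s) * (g y * R (gm (ginv y) x)))"
    using lborel_pair.integrable_snd[OF H_int] by (simp add: H_R)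
  then show "integrable lborel (\<lambda>y. g y * R (gm (ginv y) x))" using \<Gamma> by simp
  have "Gamma (1 - s) * (LINT y|lborel. g y * R (gm (ginv y) x)) = (LINT y|lborel. LINT t|lborel. H t y)"
    by (simp add: H_R)
  also have "\<dots> = (LINT t|lborel. LINT y|lborel. H t y)" by (rule lborel_pair.Fubini_integral[OF H_int])
  also have "\<dots> = (LINT t:{0<..}|lborel. t powr (- s) * heat_flow g x t)"
    unfolding set_lebesgue_integral_def
  proof (rule Bochner_Integration.integral_cong[OF refl])
    show "(LINT y|lborel. H t y) = indicator {0<..} t *\<^sub>R (t powr (- s) * heat_flow g x t)" for t
      by (cases "t > 0") (simp_all add: H_def heat_flow_eq_semigroup[OF _ cg] heat_semigroup_def)
  qed
  also have "\<dots> = s * (LINT t:{0<..}|lborel. t powr (- s - 1) * a t)" by (rule parts[symmetric])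
  finally have eq: "s / Gamma (1 - s) * (LINT t:{0<..}|lborel. t powr (- s - 1) * a t) = (LINT y|lborel. g y * R (gm (ginv y) x))"
    using \<Gamma> by (simp add: field_simps)
  show "set_integrable lborel {0<..} (\<lambda>t. t powr (- s - 1) * (heat_semigroup gm ginv p t u x - u x))"
    using int1 by (subst set_integrable_cong[OF refl]) (auto simp: a_eq)
  have "(LINT t:{0<..}|lborel. t powr (- s - 1) * (heat_semigroup gm ginv p t u x - u x))
      = (LINT t:{0<..}|lborel. t powr (- s - 1) * a t)"
    by (intro set_lebesgue_integral_cong) (auto simp: a_eq)
  then show "s / Gamma (1 - s) * (LINT t:{0<..}|lborel. t powr (- s - 1) * (heat_semigroup gm ginv p t u x - u x))
      = (LINT y|lborel. g y * R (gm (ginv y) x))"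
    using eq by simp
qed

text \<open>The two integrability clauses ensure that the equality is between absolutely convergent
  integrals and not between default values of the Lebesgue integral.\<close>

theorem lemma8p5:
  fixes gm :: "real^'n \<Rightarrow> real^'n \<Rightarrow> real^'n" and ginv :: "real^'n \<Rightarrow> real^'n"
    and \<sigma> :: "'n \<Rightarrow> nat" and B :: "(real^'n) set"
    and p :: "real^'n \<Rightarrow> real \<Rightarrow> real" and s :: real and u :: "real^'n \<Rightarrow> real" and x :: "real^'n"
  assumes "CARD('n) \<ge> 3"
    and "carnot_group gm ginv \<sigma>"
    and "horizontal_basis \<sigma> B"
    and "heat_kernel gm B p"
    and "0 < s" and "s < 1"
    and "test_fun u"
  shows "set_integrable lborel {0<..}
      (\<lambda>t. t powr (- s - 1) * (heat_semigroup gm ginv p t u x - u x)) \<and>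
    integrable lborel (\<lambda>y. sublap gm B u y * riesz_kernel p (2 - 2 * s) (gm (ginv y) x)) \<and>
    - (s / Gamma (1 - s)) * (LINT t:{0<..}|lborel.
        t powr (- s - 1) * (heat_semigroup gm ginv p t u x - u x))
      = gconv gm ginv (\<lambda>y. - sublap gm B u y) (riesz_kernel p (2 - 2 * s)) x \<and>
    gconv gm ginv (\<lambda>y. - sublap gm B u y) (riesz_kernel p (2 - 2 * s)) x
      = - (LINT y|lborel. sublap gm B u y * riesz_kernel p (2 - 2 * s) (gm (ginv y) x))"
proof -
  interpret carnot_heat gm ginv \<sigma> B p
    using assms(2-4) by (simp add: carnot_heat_def carnot_heat_axioms_def)
  note * = fractional_sublaplacian[OF assms(1,5-7), of x]
  have "gconv gm ginv (\<lambda>y. - sublap gm B u y) (riesz_kernel p (2 - 2 * s)) x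
      = - (LINT y|lborel. sublap gm B u y * riesz_kernel p (2 - 2 * s) (gm (ginv y) x))"
    by (simp add: gconv_def)
  then show ?thesis using * by (simp del: of_nat_sum)
qed

end
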